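(* Let $G$ be an $n$-dimensional Lie group with Lie algebra $\mathfrak{g}$, let $\mathsf{h}$ be a left-invariant Riemannian metric on $G$ inducing the inner product $\langle\,,\rangle$ on $\mathfrak{g}$, and let $X\in\mathfrak{g}$ be non-zero with $\|X\|=\sqrt{\langle X,X\rangle}<1$. Suppose the left-invariant Randers metric $F(x,y)=\sqrt{\mathsf{h}(y,y)}+\mathsf{h}(X(x),y)$ is of Berwald type. Let $g_X$ be the left-invariant Riemannian metric $$g_X(v,z)=(1+\|X\|)\Big(\mathsf{h}(v,z)+\frac{1}{\|X\|}\mathsf{h}(X(x),v)\,\mathsf{h}(X(x),z)\Big),\qquad v,z\in T_xG,$$ assume $\sqrt{g_X(X,X)}<1$, and let $\tilde F(x,y)=\sqrt{g_X(y,y)}+g_X(X(x),y)$. Let $\phi:\mathfrak{g}\to\mathfrak{g}$ be the linear map with $g_X(v,z)=\langle v,\phi(z)\rangle$ for all $v,z\in\mathfrak{g}$, and let $\{X_1,\dots,X_n\}$ be a $\langle\,,\rangle$-orthonormal basis of $\mathfrak{g}$ consisting of eigenvectors of $\phi$, with $\phi(X_i)=\lambda_iX_i$. Then for all $i\neq j$, with $P=\mathrm{span}\{X_i,X_j\}$, the flag curvatures of $\tilde F$ and $F$ satisfy $$K^{\tilde F}(X_j,P)=\frac{(1+\langle X,X_j\rangle)^2}{\lambda_j\big(1+\lambda_j^{1/2}\langle X,X_j\rangle\big)^2}\,K^F(X_j,P).$$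
   Context: For a Finsler metric $F$ on a manifold, let $g_y$ be the fundamental tensor, $g_{ij}(x,y)=\frac12\frac{\partial^2F^2}{\partial y^i\partial y^j}$ with inverse $g^{ij}$, and let $G^i=\frac14 g^{il}\big([F^2]_{x^ky^l}y^k-[F^2]_{x^l}\big)$ be the spray coefficients. $F$ is of Berwald type if each $G^i$ is quadratic in $y$ in every local coordinate system, i.e. $G^i=\frac12\Gamma^i_{jk}(x)y^jy^k$. The Riemann curvature $R_y:T_xM\to T_xM$ is given by $R_y(u)=R^i{}_k u^k\,\partial_{x^i}$, where $R^i{}_k=2\frac{\partial G^i}{\partial x^k}-y^j\frac{\partial^2G^i}{\partial x^j\partial y^k}+2G^j\frac{\partial^2G^i}{\partial y^j\partial y^k}-\frac{\partial G^i}{\partial y^j}\frac{\partial G^j}{\partial y^k}$. For a two-plane $P=\mathrm{span}\{u,y\}\subset T_xM$ with flagpole $y\neq0$, the flag curvature is $$K^F(y,P)=\frac{g_y(R_y(u),u)}{g_y(y,y)g_y(u,u)-g_y(y,u)^2}.$$ For left-invariant metrics on $G$, flag curvatures are evaluated at the identity, identifying $T_eG$ with $\mathfrak{g}$. *)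

theory Defs
  imports "HOL-Analysis.Analysis" "HOL-Algebra.Group"
begin

section \<open>Smooth functions between normed spaces\<close>

text \<open>Intended for open sets \<open>S\<close>; the directional derivatives characterise \<open>C\<^sup>k\<close> because all
  domains below are finite-dimensional.\<close>

primrec Ck_on :: "nat \<Rightarrow> 'a::real_normed_vector set \<Rightarrow> ('a \<Rightarrow> 'b::real_normed_vector) \<Rightarrow> bool" where
  "Ck_on 0 S f \<longleftrightarrow> continuous_on S f"
| "Ck_on (Suc k) S f \<longleftrightarrow> (\<forall>x\<in>S. f differentiable (at x)) \<and>
      (\<forall>v. Ck_on k S (\<lambda>x. frechet_derivative f (at x) v))"

definition smooth_on :: "'a::real_normed_vector set \<Rightarrow> ('a \<Rightarrow> 'b::real_normed_vector) \<Rightarrow> bool" where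
  "smooth_on S f \<longleftrightarrow> (\<forall>k. Ck_on k S f)"


section \<open>Smooth manifolds\<close>

text \<open>The values of the coordinate map outside the domain of the chart are irrelevant.\<close>

type_synonym ('m, 'n) chart = "'m set \<times> ('m \<Rightarrow> real ^ 'n)"

abbreviation chart_dom :: "('m, 'n) chart \<Rightarrow> 'm set" where "chart_dom \<equiv> fst"

abbreviation chart_map :: "('m, 'n) chart \<Rightarrow> 'm \<Rightarrow> real ^ 'n" where "chart_map \<equiv> snd"

definition chart_img :: "('m, 'n) chart \<Rightarrow> (real ^ 'n) set" where
  "chart_img c = chart_map c ` chart_dom c"

definition chart_inv :: "('m, 'n) chart \<Rightarrow> real ^ 'n \<Rightarrow> 'm" where
  "chart_inv c = inv_into (chart_dom c) (chart_map c)"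

definition is_chart :: "'m topology \<Rightarrow> ('m, 'n::finite) chart \<Rightarrow> bool" where
  "is_chart T c \<longleftrightarrow> openin T (chart_dom c) \<and> open (chart_img c) \<and>
     homeomorphic_map (subtopology T (chart_dom c)) (top_of_set (chart_img c)) (chart_map c)"

definition compatible :: "('m, 'n::finite) chart \<Rightarrow> ('m, 'n) chart \<Rightarrow> bool" where
  "compatible c d \<longleftrightarrow>
     smooth_on (chart_map c ` (chart_dom c \<inter> chart_dom d)) (chart_map d \<circ> chart_inv c) \<and>
     smooth_on (chart_map d ` (chart_dom c \<inter> chart_dom d)) (chart_map c \<circ> chart_inv d)"

text \<open>\<open>A\<close> is the maximal atlas, so its elements are all the local coordinate systems of the
  manifold.\<close>

locale smooth_manifold =
  fixes T :: "'m topology" and A :: "('m, 'n::finite) chart set"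
  assumes Hausdorff: "Hausdorff_space T"
    and second_countable: "second_countable T"
    and charts: "\<And>c. c \<in> A \<Longrightarrow> is_chart T c"
    and covering: "(\<Union>c\<in>A. chart_dom c) = topspace T"
    and compatible: "\<And>c d. c \<in> A \<Longrightarrow> d \<in> A \<Longrightarrow> compatible c d"
    and maximal: "\<And>c. is_chart T c \<Longrightarrow> (\<And>d. d \<in> A \<Longrightarrow> compatible c d) \<Longrightarrow> c \<in> A"


section \<open>Tangent vectors\<close>

text \<open>The tangent space at \<open>x\<close> is modelled as \<^typ>\<open>real ^ 'n\<close>: a tangent vector is
  given by its components in one fixed chart \<open>chart_at A x\<close> around \<open>x\<close>. Its components in any
  other chart \<open>c\<close> around \<open>x\<close> are \<open>to_coords A c x v\<close>, and \<open>from_coords A c x\<close> is the inverse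
  isomorphism.\<close>

definition chart_at :: "('m, 'n) chart set \<Rightarrow> 'm \<Rightarrow> ('m, 'n) chart" where
  "chart_at A x = (SOME c. c \<in> A \<and> x \<in> chart_dom c)"

definition to_coords ::
    "('m, 'n::finite) chart set \<Rightarrow> ('m, 'n) chart \<Rightarrow> 'm \<Rightarrow> real ^ 'n \<Rightarrow> real ^ 'n" where
  "to_coords A c x v =
     frechet_derivative (chart_map c \<circ> chart_inv (chart_at A x)) (at (chart_map (chart_at A x) x)) v"

definition from_coords ::
    "('m, 'n::finite) chart set \<Rightarrow> ('m, 'n) chart \<Rightarrow> 'm \<Rightarrow> real ^ 'n \<Rightarrow> real ^ 'n" where
  "from_coords A c x \<eta> =
     frechet_derivative (chart_map (chart_at A x) \<circ> chart_inv c) (at (chart_map c x)) \<eta>"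

definition differential ::
    "('m, 'n::finite) chart set \<Rightarrow> ('m \<Rightarrow> 'm) \<Rightarrow> 'm \<Rightarrow> real ^ 'n \<Rightarrow> real ^ 'n" where
  "differential A f x v =
     frechet_derivative (chart_map (chart_at A (f x)) \<circ> f \<circ> chart_inv (chart_at A x))
       (at (chart_map (chart_at A x) x)) v"


section \<open>Lie groups and left-invariant objects\<close>

locale lie_group = group G + smooth_manifold T A
  for G :: "('g, 'k) monoid_scheme" (structure)
    and T :: "'g topology" and A :: "('g, 'n::finite) chart set" +
  assumes topspace_eq: "topspace T = carrier G"
    and continuous_mult: "continuous_map (prod_topology T T) T (\<lambda>(x, y). x \<otimes> y)"
    and smooth_mult: "\<And>c d e. c \<in> A \<Longrightarrow> d \<in> A \<Longrightarrow> e \<in> A \<Longrightarrow>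
      smooth_on {(\<xi>, \<eta>). \<xi> \<in> chart_img c \<and> \<eta> \<in> chart_img d \<and>
                         chart_inv c \<xi> \<otimes> chart_inv d \<eta> \<in> chart_dom e}
        (\<lambda>(\<xi>, \<eta>). chart_map e (chart_inv c \<xi> \<otimes> chart_inv d \<eta>))"
    and continuous_inverse: "continuous_map T T (m_inv G)"
    and smooth_inverse: "\<And>c e. c \<in> A \<Longrightarrow> e \<in> A \<Longrightarrow>
      smooth_on {\<xi>. \<xi> \<in> chart_img c \<and> m_inv G (chart_inv c \<xi>) \<in> chart_dom e}
        (\<lambda>\<xi>. chart_map e (m_inv G (chart_inv c \<xi>)))"

definition left_invariant_field ::
    "('g, 'k) monoid_scheme \<Rightarrow> ('g, 'n::finite) chart set \<Rightarrow> real ^ 'n \<Rightarrow> 'g \<Rightarrow> real ^ 'n" where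
  "left_invariant_field G A X x = differential A (\<lambda>z. x \<otimes>\<^bsub>G\<^esub> z) \<one>\<^bsub>G\<^esub> X"

definition riemannian_metric ::
    "'m topology \<Rightarrow> ('m, 'n::finite) chart set \<Rightarrow> ('m \<Rightarrow> real ^ 'n \<Rightarrow> real ^ 'n \<Rightarrow> real) \<Rightarrow> bool" where
  "riemannian_metric T A h \<longleftrightarrow>
     (\<forall>x\<in>topspace T. bilinear (h x) \<and> (\<forall>v w. h x v w = h x w v) \<and> (\<forall>v. v \<noteq> 0 \<longrightarrow> h x v v > 0)) \<and>
     (\<forall>c\<in>A. \<forall>i j. smooth_on (chart_img c)
        (\<lambda>\<xi>. h (chart_inv c \<xi>) (from_coords A c (chart_inv c \<xi>) (axis i 1))
                               (from_coords A c (chart_inv c \<xi>) (axis j 1))))"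

definition left_invariant_metric ::
    "('g, 'k) monoid_scheme \<Rightarrow> ('g, 'n::finite) chart set \<Rightarrow>
     ('g \<Rightarrow> real ^ 'n \<Rightarrow> real ^ 'n \<Rightarrow> real) \<Rightarrow> bool" where
  "left_invariant_metric G A h \<longleftrightarrow>
     (\<forall>a\<in>carrier G. \<forall>x\<in>carrier G. \<forall>v w.
        h (a \<otimes>\<^bsub>G\<^esub> x) (differential A (\<lambda>z. a \<otimes>\<^bsub>G\<^esub> z) x v) (differential A (\<lambda>z. a \<otimes>\<^bsub>G\<^esub> z) x w)
          = h x v w)"


section \<open>Finsler geometry in local coordinates\<close>

text \<open>\<open>local_rep A c F\<close> is \<open>F\<close> as a function \<open>F(x, y)\<close> of the coordinates \<open>x\<^sup>i\<close> of the base point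
  and the components \<open>y\<^sup>i\<close> of the tangent vector with respect to the chart \<open>c\<close>. In this section
  \<open>F\<close> is otherwise such a coordinate expression. It is only smooth for \<open>y \<noteq> 0\<close>.\<close>

definition local_rep ::
    "('m, 'n::finite) chart set \<Rightarrow> ('m, 'n) chart \<Rightarrow> ('m \<Rightarrow> real ^ 'n \<Rightarrow> real) \<Rightarrow>
     real ^ 'n \<Rightarrow> real ^ 'n \<Rightarrow> real" where
  "local_rep A c F x y = F (chart_inv c x) (from_coords A c (chart_inv c x) y)"

definition partial_x ::
    "'n::finite \<Rightarrow> (real ^ 'n \<Rightarrow> real ^ 'n \<Rightarrow> real) \<Rightarrow> real ^ 'n \<Rightarrow> real ^ 'n \<Rightarrow> real" where
  "partial_x k f x y = deriv (\<lambda>t. f (x + t *\<^sub>R axis k 1) y) 0"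

definition partial_y ::
    "'n::finite \<Rightarrow> (real ^ 'n \<Rightarrow> real ^ 'n \<Rightarrow> real) \<Rightarrow> real ^ 'n \<Rightarrow> real ^ 'n \<Rightarrow> real" where
  "partial_y k f x y = deriv (\<lambda>t. f x (y + t *\<^sub>R axis k 1)) 0"

definition fundamental_tensor ::
    "(real ^ 'n \<Rightarrow> real ^ 'n \<Rightarrow> real) \<Rightarrow> real ^ 'n \<Rightarrow> real ^ 'n \<Rightarrow> real ^ 'n ^ ('n::finite)" where
  "fundamental_tensor F x y = (\<chi> i j. 1/2 * partial_y i (partial_y j (\<lambda>x y. (F x y)\<^sup>2)) x y)"

definition fundamental_form ::
    "(real ^ 'n \<Rightarrow> real ^ 'n \<Rightarrow> real) \<Rightarrow> real ^ 'n \<Rightarrow> real ^ 'n \<Rightarrow>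
     real ^ 'n \<Rightarrow> real ^ ('n::finite) \<Rightarrow> real" where
  "fundamental_form F x y u v = (\<Sum>i\<in>UNIV. \<Sum>j\<in>UNIV. fundamental_tensor F x y $ i $ j * u $ i * v $ j)"

definition spray ::
    "(real ^ 'n \<Rightarrow> real ^ 'n \<Rightarrow> real) \<Rightarrow> 'n::finite \<Rightarrow> real ^ 'n \<Rightarrow> real ^ 'n \<Rightarrow> real" where
  "spray F i x y = 1/4 * (\<Sum>l\<in>UNIV. matrix_inv (fundamental_tensor F x y) $ i $ l *
     ((\<Sum>k\<in>UNIV. partial_y l (partial_x k (\<lambda>x y. (F x y)\<^sup>2)) x y * y $ k)
       - partial_x l (\<lambda>x y. (F x y)\<^sup>2) x y))"

definition riemann_coeff ::
    "(real ^ 'n \<Rightarrow> real ^ 'n \<Rightarrow> real) \<Rightarrow> 'n::finite \<Rightarrow> 'n \<Rightarrow> real ^ 'n \<Rightarrow> real ^ 'n \<Rightarrow> real" where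
  "riemann_coeff F i k x y =
       2 * partial_x k (spray F i) x y
     - (\<Sum>j\<in>UNIV. y $ j * partial_x j (partial_y k (spray F i)) x y)
     + 2 * (\<Sum>j\<in>UNIV. spray F j x y * partial_y j (partial_y k (spray F i)) x y)
     - (\<Sum>j\<in>UNIV. partial_y j (spray F i) x y * partial_y k (spray F j) x y)"

definition riemann_curvature ::
    "(real ^ 'n \<Rightarrow> real ^ 'n \<Rightarrow> real) \<Rightarrow> real ^ 'n \<Rightarrow> real ^ 'n \<Rightarrow> real ^ 'n \<Rightarrow> real ^ ('n::finite)" where
  "riemann_curvature F x y u = (\<chi> i. \<Sum>k\<in>UNIV. riemann_coeff F i k x y * u $ k)"

definition berwald_type :: "('m, 'n::finite) chart set \<Rightarrow> ('m \<Rightarrow> real ^ 'n \<Rightarrow> real) \<Rightarrow> bool" where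
  "berwald_type A F \<longleftrightarrow>
     (\<forall>c\<in>A. \<exists>\<Gamma> :: 'n \<Rightarrow> 'n \<Rightarrow> 'n \<Rightarrow> real ^ 'n \<Rightarrow> real.
        \<forall>x\<in>chart_img c. \<forall>y. y \<noteq> 0 \<longrightarrow> (\<forall>i.
          spray (local_rep A c F) i x y = 1/2 * (\<Sum>j\<in>UNIV. \<Sum>k\<in>UNIV. \<Gamma> i j k x * y $ j * y $ k)))"

definition flag_quotient ::
    "(real ^ 'n \<Rightarrow> real ^ 'n \<Rightarrow> real) \<Rightarrow> real ^ 'n \<Rightarrow> real ^ 'n \<Rightarrow> real ^ ('n::finite) \<Rightarrow> real" where
  "flag_quotient F x y u =
     fundamental_form F x y (riemann_curvature F x y u) u /
     (fundamental_form F x y y y * fundamental_form F x y u u - (fundamental_form F x y y u)\<^sup>2)"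

text \<open>The flag curvature at \<open>p\<close> of the two-plane \<open>P\<close> with flagpole \<open>y\<close>, evaluated in the local
  coordinates \<open>c\<close> around \<open>p\<close>: the common value of the quotient over all \<open>u\<close> spanning \<open>P\<close> together
  with \<open>y\<close>. The vectors \<open>y\<close>, \<open>u\<close> and the plane \<open>P\<close> live in the tangent space at \<open>p\<close>.\<close>

definition flag_curvature ::
    "('m, 'n::finite) chart set \<Rightarrow> ('m, 'n) chart \<Rightarrow> ('m \<Rightarrow> real ^ 'n \<Rightarrow> real) \<Rightarrow> 'm \<Rightarrow>
     real ^ 'n \<Rightarrow> (real ^ 'n) set \<Rightarrow> real" where
  "flag_curvature A c F p y P =
     (THE K. \<forall>u. span {u, y} = P \<longrightarrow>
        K = flag_quotient (local_rep A c F) (chart_map c p) (to_coords A c p y) (to_coords A c p u))"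

definition randers_metric ::
    "('m \<Rightarrow> real ^ 'n \<Rightarrow> real ^ 'n \<Rightarrow> real) \<Rightarrow> ('m \<Rightarrow> real ^ 'n) \<Rightarrow> 'm \<Rightarrow> real ^ ('n::finite) \<Rightarrow> real" where
  "randers_metric h V x y = sqrt (h x y y) + h x (V x) y"

end

theory Submission
  imports Defs
begin

text \<open>
  Write \<open>\<alpha>(y)\<^sup>2 = h(y, y)\<close> and \<open>\<beta>(y) = h(X, y)\<close>, so that \<open>F = \<alpha> + \<beta>\<close>. Being of Berwald type means that the
  spray is \<open>G = 1/2 \<Gamma>(y, y)\<close> for a symmetric bilinear \<open>\<Gamma>\<^sub>x\<close>. The spray is determined by a linear equation
  whose coefficients are built from \<open>F\<close> and its derivatives. Under \<open>y \<mapsto> - y\<close> the function \<open>\<alpha>\<close> is even,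
  \<open>\<beta>\<close> is odd and \<open>\<Gamma>(y, y)\<close> is even; separating the even from the odd part of the equation yields that \<open>\<Gamma>\<close>
  is the Levi-Civita connection of \<open>h\<close> and that \<open>\<beta>\<close> is parallel for it (\<open>quadratic_spray_imp_parallel\<close>).

  The length of \<open>X\<close> is constant by left-invariance. Hence \<open>g\<^sub>X\<close> and the one-form \<open>g\<^sub>X(X, _)\<close> are
  combinations of \<open>h\<close>, \<open>\<beta> \<otimes> \<beta>\<close> and \<open>\<beta>\<close> with constant coefficients, so both are parallel for the same \<open>\<Gamma>\<close>
  (\<open>parallel_transfer\<close>). For a Randers metric whose two ingredients are parallel for \<open>\<Gamma>\<close> the spray is
  again \<open>1/2 \<Gamma>(y, y)\<close> (\<open>parallel_imp_quadratic_spray\<close>). Thus both Finsler metrics have the same spray,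
  and therefore the same Riemann curvature \<open>R\<^sub>y(u) = R(u, y)y\<close>.

  A parallel form is annihilated by curvature because its second derivatives commute: \<open>\<beta>(R\<^sub>y(u)) = 0\<close>
  and \<open>h(R\<^sub>y(u), y) = 0\<close> (\<open>parallel_curvature\<close>). With these two facts the fundamental tensor drops out of
  the flag curvature up to one factor (\<open>flag_quotient_eq\<close>): if \<open>u\<close> is orthogonal to \<open>y\<close>, the flag curvature
  is \<open>h(R\<^sub>y(u), u) / (F(y)\<^sup>2 h(u, u))\<close>. For \<open>u = X\<^sub>i\<close>, \<open>y = X\<^sub>j\<close> the passage from \<open>h\<close> to \<open>g\<^sub>X\<close> multiplies
  numerator and denominator by the eigenvalue \<open>\<lambda>\<^sub>i\<close>, so the two flag curvatures differ only through \<open>F(y)\<^sup>2\<close>.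
  The stated ratio is the quotient of the squares of \<open>F(X\<^sub>j) = 1 + \<langle>X, X\<^sub>j\<rangle>\<close> and of the value
  \<open>\<lambda>\<^sub>j\<^sup>1\<^sup>/\<^sup>2 + \<lambda>\<^sub>j \<langle>X, X\<^sub>j\<rangle>\<close> of the second metric at \<open>X\<^sub>j\<close>.

  All of this takes place in the coordinates of a chart. The link with the group is that the coordinates
  of a left-invariant field are a partial derivative of the multiplication, hence smooth
  (\<open>left_invariant_field_coords\<close>).
\<close>

section \<open>Functions of class \<open>C\<^sup>k\<close>\<close>

lemma Ck_on_Suc_D: "Ck_on (Suc k) S f \<Longrightarrow> Ck_on k S f"
proof (induction k arbitrary: f)
  case 0
  then show ?case
    by (auto intro!: continuous_at_imp_continuous_on differentiable_imp_continuous_within)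
next
  case (Suc k)
  have "Ck_on k S (\<lambda>x. frechet_derivative f (at x) v)" for v
    using Ck_on.simps(2)[THEN iffD1, OF Suc.prems] by (blast intro: Suc.IH)
  then show ?case
    using Ck_on.simps(2)[THEN iffD1, OF Suc.prems] by simp
qed

text \<open>
  On an open set the derivatives see only the values on the set, so functions that are arbitrary outside
  a chart may be replaced by convenient ones.
\<close>

lemma Ck_on_cong:
  assumes "Ck_on k S f" "open S" "\<And>x. x \<in> S \<Longrightarrow> f x = g x"
  shows "Ck_on k S g"
  using assms(1,3)
proof (induction k arbitrary: f g)
  case 0
  then show ?case by (simp cong: continuous_on_cong)
next
  case (Suc k)
  have diff: "f differentiable (at x)" if "x \<in> S" for x
    using Suc.prems(1) that by simp
  have "g differentiable (at x)" if x: "x \<in> S" for x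
  proof -
    obtain D where "(f has_derivative D) (at x)"
      using diff[OF x] by (auto simp: differentiable_def)
    from has_derivative_transform_within_open[OF this assms(2) x Suc.prems(2)]
    show ?thesis by (auto simp: differentiable_def)
  qed
  moreover have "Ck_on k S (\<lambda>x. frechet_derivative g (at x) v)" for v
  proof (rule Suc.IH)
    show "Ck_on k S (\<lambda>x. frechet_derivative f (at x) v)" using Suc.prems(1) by simp
    show "frechet_derivative f (at x) v = frechet_derivative g (at x) v" if "x \<in> S" for x
      using frechet_derivative_transform_within_open[OF diff[OF that] assms(2) that Suc.prems(2)]
      by simp
  qed
  ultimately show ?case by simp
qed

lemma Ck_on_const: "Ck_on k S (\<lambda>x. c)"
  by (induction k arbitrary: c) auto

lemma Ck_on_add:
  assumes "open S" "Ck_on k S f" "Ck_on k S g"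
  shows "Ck_on k S (\<lambda>x. f x + g x)"
  using assms(2,3)
proof (induction k arbitrary: f g)
  case 0
  then show ?case by (simp add: continuous_on_add)
next
  case (Suc k)
  have df: "(f has_derivative frechet_derivative f (at x)) (at x)"
    and dg: "(g has_derivative frechet_derivative g (at x)) (at x)" if "x \<in> S" for x
    using Suc.prems that by (simp_all add: frechet_derivative_works)
  note d = has_derivative_add[OF df dg]
  have "Ck_on k S (\<lambda>x. frechet_derivative (\<lambda>x. f x + g x) (at x) v)" for v
  proof (rule Ck_on_cong[OF Suc.IH assms(1)])
    show "Ck_on k S (\<lambda>x. frechet_derivative f (at x) v)"
         "Ck_on k S (\<lambda>x. frechet_derivative g (at x) v)"
      using Suc.prems by simp_all
  next
    fix x assume "x \<in> S"
    then show "frechet_derivative f (at x) v + frechet_derivative g (at x) v =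
        frechet_derivative (\<lambda>x. f x + g x) (at x) v"
      by (simp add: frechet_derivative_at[OF d, symmetric])
  qed
  then show ?case using d by (auto simp: differentiable_def)
qed

lemma Ck_on_mult:
  fixes f g :: "'a::real_normed_vector \<Rightarrow> real"
  assumes "open S" "Ck_on k S f" "Ck_on k S g"
  shows "Ck_on k S (\<lambda>x. f x * g x)"
  using assms(2,3)
proof (induction k arbitrary: f g)
  case 0
  then show ?case by (simp add: continuous_on_mult)
next
  case (Suc k)
  have df: "(f has_derivative frechet_derivative f (at x)) (at x)"
    and dg: "(g has_derivative frechet_derivative g (at x)) (at x)" if "x \<in> S" for x
    using Suc.prems that by (simp_all add: frechet_derivative_works)
  note d = has_derivative_mult[OF df dg]
  have "Ck_on k S (\<lambda>x. frechet_derivative (\<lambda>x. f x * g x) (at x) v)" for v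
  proof (rule Ck_on_cong[OF _ assms(1)])
    have "Ck_on k S f" "Ck_on k S g"
      using Suc.prems by (simp_all only: Ck_on_Suc_D)
    moreover have "Ck_on k S (\<lambda>x. frechet_derivative f (at x) v)"
         "Ck_on k S (\<lambda>x. frechet_derivative g (at x) v)"
      using Suc.prems by simp_all
    ultimately show "Ck_on k S (\<lambda>x. f x * frechet_derivative g (at x) v +
        frechet_derivative f (at x) v * g x)"
      by (intro Ck_on_add[OF assms(1)] Suc.IH)
  next
    fix x assume "x \<in> S"
    then show "f x * frechet_derivative g (at x) v + frechet_derivative f (at x) v * g x =
        frechet_derivative (\<lambda>x. f x * g x) (at x) v"
      by (simp add: frechet_derivative_at[OF d, symmetric])
  qed
  then show ?case using d by (auto simp: differentiable_def)
qed

lemma Ck_on_sum: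
  assumes "open S" "\<And>i. i \<in> I \<Longrightarrow> Ck_on k S (f i)"
  shows "Ck_on k S (\<lambda>x. \<Sum>i\<in>I. f i x)"
  using assms(2)
proof (induction I rule: infinite_finite_induct)
  case (insert i I)
  then show ?case by (auto intro!: Ck_on_add assms(1))
qed (auto simp: Ck_on_const)

lemma Ck_on_bounded_linear_comp:
  assumes "open S" "bounded_linear L" "Ck_on k S f"
  shows "Ck_on k S (\<lambda>x. L (f x))"
  using assms(3)
proof (induction k arbitrary: f)
  case 0
  then show ?case by (simp add: bounded_linear.continuous_on[OF assms(2)])
next
  case (Suc k)
  have df: "(f has_derivative frechet_derivative f (at x)) (at x)" if "x \<in> S" for x
    using Suc.prems that by (simp add: frechet_derivative_works)
  note d = bounded_linear.has_derivative[OF assms(2) df]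
  have "Ck_on k S (\<lambda>x. frechet_derivative (\<lambda>x. L (f x)) (at x) v)" for v
  proof (rule Ck_on_cong[OF Suc.IH assms(1)])
    show "Ck_on k S (\<lambda>x. frechet_derivative f (at x) v)" using Suc.prems by simp
  next
    fix x assume "x \<in> S"
    then show "L (frechet_derivative f (at x) v) = frechet_derivative (\<lambda>x. L (f x)) (at x) v"
      by (simp add: frechet_derivative_at[OF d, symmetric])
  qed
  then show ?case using d by (auto simp: differentiable_def)
qed

text \<open>
  \<open>C\<^sup>k\<close> on \<open>W\<close> refers to full derivatives at the points of \<open>W\<close>; their values on vectors \<open>(v, 0)\<close>
  are the derivatives of the slice.
\<close>

lemma Ck_on_slice:
  assumes "open S" "\<And>x. x \<in> S \<Longrightarrow> (x, b) \<in> W" "Ck_on k W f"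
  shows "Ck_on k S (\<lambda>x. f (x, b))"
  using assms(3)
proof (induction k arbitrary: f)
  case 0
  have "continuous_on ((\<lambda>x. (x, b)) ` S) f"
    by (rule continuous_on_subset) (use 0 assms(2) in auto)
  then show ?case
    using continuous_on_compose[of S "\<lambda>x. (x, b)" f]
    by (simp add: comp_def continuous_on_Pair)
next
  case (Suc k)
  have d: "((\<lambda>x. f (x, b)) has_derivative (\<lambda>v. frechet_derivative f (at (x, b)) (v, 0))) (at x)"
    if "x \<in> S" for x
  proof -
    have "(f has_derivative frechet_derivative f (at (x, b))) (at (x, b))"
      using Suc.prems assms(2)[OF that] by (simp add: frechet_derivative_works)
    moreover have "((\<lambda>x. (x, b)) has_derivative (\<lambda>v. (v, 0))) (at x)"
      by (auto intro!: derivative_eq_intros)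
    ultimately show ?thesis
      using has_derivative_compose[of "\<lambda>x. (x, b)"] by fast
  qed
  have "Ck_on k S (\<lambda>x. frechet_derivative (\<lambda>x. f (x, b)) (at x) v)" for v
  proof (rule Ck_on_cong[OF _ assms(1)])
    show "Ck_on k S (\<lambda>x. frechet_derivative f (at (x, b)) (v, 0))"
      by (rule Suc.IH) (use Suc.prems in simp)
  next
    fix x assume "x \<in> S"
    then show "frechet_derivative f (at (x, b)) (v, 0) = frechet_derivative (\<lambda>x. f (x, b)) (at x) v"
      by (simp add: frechet_derivative_at[OF d, symmetric])
  qed
  then show ?case using d by (auto simp: differentiable_def)
qed

section \<open>Symmetry of second derivatives\<close>

text \<open>
  The mean value theorem along \<open>u\<close> and then along \<open>w\<close> expresses the second difference over a small
  parallelogram by the second derivative in the order \<open>u\<close>, \<open>w\<close>. The second difference itself does not change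
  when \<open>u\<close> and \<open>w\<close> are exchanged, which is what forces the two orders to agree in the limit.
\<close>

lemma second_difference_mean_value:
  fixes f :: "'a::real_normed_vector \<Rightarrow> real"
  assumes s: "s > 0"
    and S: "\<And>a b. \<lbrakk>0 \<le> a; a \<le> s; 0 \<le> b; b \<le> s\<rbrakk> \<Longrightarrow> x + a *\<^sub>R u + b *\<^sub>R w \<in> S"
    and f: "\<And>z. z \<in> S \<Longrightarrow> (f has_derivative f' z) (at z)"
    and f': "\<And>z. z \<in> S \<Longrightarrow> ((\<lambda>z. f' z u) has_derivative f'' z) (at z)"
  obtains a b where "0 \<le> a" "a \<le> s" "0 \<le> b" "b \<le> s"
    "f (x + s *\<^sub>R u + s *\<^sub>R w) - f (x + s *\<^sub>R u) - f (x + s *\<^sub>R w) + f x =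
      s * s * f'' (x + a *\<^sub>R u + b *\<^sub>R w) w"
proof -
  have line: "((\<lambda>t. g (c + t *\<^sub>R v)) has_real_derivative g' v) (at t)"
    if "(g has_derivative g') (at (c + t *\<^sub>R v))" for g :: "'a \<Rightarrow> real" and g' c v t
  proof -
    have "((\<lambda>t. c + t *\<^sub>R v) has_derivative (\<lambda>r. r *\<^sub>R v)) (at t)"
      by (auto intro!: derivative_eq_intros)
    then have "((\<lambda>t. g (c + t *\<^sub>R v)) has_derivative (\<lambda>r. g' (r *\<^sub>R v))) (at t)"
      using has_derivative_compose that by blast
    moreover have "g' (r *\<^sub>R v) = g' v * r" for r
      using has_derivative_linear[OF that] by (simp add: linear_cmul)
    ultimately show ?thesis
      by (simp add: has_field_derivative_def)
  qed
  let ?g = "\<lambda>a. f (x + s *\<^sub>R w + a *\<^sub>R u) - f (x + a *\<^sub>R u)"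
  have "(?g has_real_derivative
      f' (x + s *\<^sub>R w + a *\<^sub>R u) u - f' (x + a *\<^sub>R u) u) (at a)" if "0 \<le> a" "a \<le> s" for a
    using that s S[of a s] S[of a 0]
    by (intro DERIV_diff line f) (simp_all add: algebra_simps)
  from MVT2[OF s this] obtain a where a: "0 < a" "a < s"
    "?g s - ?g 0 = s * (f' (x + s *\<^sub>R w + a *\<^sub>R u) u - f' (x + a *\<^sub>R u) u)" by auto
  have "((\<lambda>b. f' (x + a *\<^sub>R u + b *\<^sub>R w) u) has_real_derivative
      f'' (x + a *\<^sub>R u + b *\<^sub>R w) w) (at b)" if "0 \<le> b" "b \<le> s" for b
    using that a S[of a b] by (intro line f') auto
  from MVT2[OF s this] obtain b where b: "0 < b" "b < s"
    "f' (x + a *\<^sub>R u + s *\<^sub>R w) u - f' (x + a *\<^sub>R u) u = s * f'' (x + a *\<^sub>R u + b *\<^sub>R w) w"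
    by auto
  show thesis
    using a b by (intro that[of a b]) (auto simp: algebra_simps)
qed

text \<open>
  Both orders of differentiation take the same value at suitable points of an arbitrarily small
  parallelogram at \<open>x\<close>; continuity moves these points to \<open>x\<close>.
\<close>

lemma Ck_on_second_derivative_symmetric:
  fixes f :: "'a::real_normed_vector \<Rightarrow> real"
  assumes "open S" "x \<in> S" and C2: "Ck_on 2 S f"
  shows "frechet_derivative (\<lambda>z. frechet_derivative f (at z) u) (at x) w =
         frechet_derivative (\<lambda>z. frechet_derivative f (at z) w) (at x) u"
proof -
  define H where "H u w z = frechet_derivative (\<lambda>z. frechet_derivative f (at z) u) (at z) w" for u w z
  have f: "(f has_derivative frechet_derivative f (at z)) (at z)" if "z \<in> S" for z
    using C2 that by (simp add: numeral_2_eq_2 frechet_derivative_works)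
  have f': "((\<lambda>z. frechet_derivative f (at z) u) has_derivative (\<lambda>w. H u w z)) (at z)"
    if "z \<in> S" for z u
    using C2 that by (simp add: numeral_2_eq_2 frechet_derivative_works H_def)
  have cont: "isCont (H u w) x" for u w
  proof -
    have "continuous_on S (H u w)"
      using C2 by (simp add: numeral_2_eq_2 H_def[abs_def])
    then show ?thesis
      using assms(1,2) by (simp add: continuous_on_eq_continuous_at)
  qed
  have "dist (H u w x) (H w u x) < e" if "e > 0" for e
  proof -
    obtain d0 where d0: "d0 > 0" "ball x d0 \<subseteq> S"
      using assms(1,2) openE by blast
    obtain d1 where d1: "d1 > 0" "\<And>z. dist z x < d1 \<Longrightarrow> dist (H u w z) (H u w x) < e/2"
      using cont[of u w] \<open>e > 0\<close> unfolding continuous_at_eps_delta by (meson half_gt_zero)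
    obtain d2 where d2: "d2 > 0" "\<And>z. dist z x < d2 \<Longrightarrow> dist (H w u z) (H w u x) < e/2"
      using cont[of w u] \<open>e > 0\<close> unfolding continuous_at_eps_delta by (meson half_gt_zero)
    define d where "d = min d0 (min d1 d2)"
    \<comment> \<open>A parallelogram with sides \<open>s u\<close> and \<open>s w\<close> lies within \<open>d / 2\<close> of \<open>x\<close>; the summand 1 keeps \<open>K\<close> positive.\<close>
    define K where "K = norm u + norm w + 1"
    define s where "s = d / (2 * K)"
    have "d > 0" using d0 d1 d2 by (simp add: d_def)
    have pos: "K > 0" by (simp add: K_def add_nonneg_pos)
    then have s: "s > 0" using \<open>d > 0\<close> by (simp add: s_def)
    have near: "dist (x + a *\<^sub>R u + b *\<^sub>R w) x < d" if "0 \<le> a" "a \<le> s" "0 \<le> b" "b \<le> s" for a b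
    proof -
      have "dist (x + a *\<^sub>R u + b *\<^sub>R w) x \<le> a * norm u + b * norm w"
        using that norm_triangle_ineq[of "a *\<^sub>R u" "b *\<^sub>R w"] by (simp add: dist_norm)
      also have "\<dots> \<le> s * norm u + s * norm w"
        using that by (intro add_mono mult_right_mono) auto
      also have "\<dots> \<le> s * K"
        using s by (simp add: K_def algebra_simps)
      also have "\<dots> = d / 2"
        using pos by (simp add: s_def)
      finally show ?thesis using \<open>d > 0\<close> by simp
    qed
    have inS: "x + a *\<^sub>R u + b *\<^sub>R w \<in> S" if "0 \<le> a" "a \<le> s" "0 \<le> b" "b \<le> s" for a b
      using near[OF that] d0 by (auto simp: d_def dist_commute)
    then have inS': "x + a *\<^sub>R w + b *\<^sub>R u \<in> S" if "0 \<le> a" "a \<le> s" "0 \<le> b" "b \<le> s" for a b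
      using inS[of b a] that by (simp add: add.assoc add.commute[of "b *\<^sub>R u"])
    obtain a b where ab: "0 \<le> a" "a \<le> s" "0 \<le> b" "b \<le> s"
      "f (x + s *\<^sub>R u + s *\<^sub>R w) - f (x + s *\<^sub>R u) - f (x + s *\<^sub>R w) + f x =
        s * s * H u w (x + a *\<^sub>R u + b *\<^sub>R w)"
      using second_difference_mean_value[OF s inS f f'] by blast
    obtain a' b' where ab': "0 \<le> a'" "a' \<le> s" "0 \<le> b'" "b' \<le> s"
      "f (x + s *\<^sub>R w + s *\<^sub>R u) - f (x + s *\<^sub>R w) - f (x + s *\<^sub>R u) + f x =
        s * s * H w u (x + a' *\<^sub>R w + b' *\<^sub>R u)"
      using second_difference_mean_value[OF s inS' f f'] by blast
    have "x + s *\<^sub>R w + s *\<^sub>R u = x + s *\<^sub>R u + s *\<^sub>R w" by simp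
    then have eq: "H u w (x + a *\<^sub>R u + b *\<^sub>R w) = H w u (x + b' *\<^sub>R u + a' *\<^sub>R w)"
      using ab(5) ab'(5) s by (simp add: algebra_simps)
    have "dist (H u w (x + a *\<^sub>R u + b *\<^sub>R w)) (H u w x) < e/2"
      using near[OF ab(1-4)] by (intro d1) (simp add: d_def)
    moreover have "dist (H w u (x + b' *\<^sub>R u + a' *\<^sub>R w)) (H w u x) < e/2"
      using near[OF ab'(3,4,1,2)] by (intro d2) (simp add: d_def)
    ultimately show ?thesis
      using eq by (metis dist_triangle_half_r)
  qed
  then have "H u w x = H w u x"
    by (metis dist_eq_0_iff less_irrefl zero_less_dist_iff)
  then show ?thesis by (simp add: H_def)
qed

section \<open>Derivatives along coordinate lines\<close>

lemma linear_sum_axis: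
  fixes f :: "real ^ 'n \<Rightarrow> 'a::real_vector"
  assumes "linear f"
  shows "(\<Sum>k\<in>UNIV. y $ k *\<^sub>R f (axis k 1)) = f y"
proof -
  have "y = (\<Sum>k\<in>UNIV. y $ k *\<^sub>R axis k 1)"
    using basis_expansion[of y] by (simp add: scalar_mult_eq_scaleR)
  then have "f y = f (\<Sum>k\<in>UNIV. y $ k *\<^sub>R axis k 1)" by simp
  also have "\<dots> = (\<Sum>k\<in>UNIV. y $ k *\<^sub>R f (axis k 1))"
    by (simp add: linear_sum[OF assms] linear_cmul[OF assms])
  finally show ?thesis by simp
qed

lemma has_derivative_line:
  fixes f :: "'a::real_normed_vector \<Rightarrow> real"
  assumes "(f has_derivative f') (at x)"
  shows "((\<lambda>t. f (x + t *\<^sub>R v)) has_real_derivative f' v) (at 0)"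
proof -
  have "((\<lambda>t. x + t *\<^sub>R v) has_derivative (\<lambda>r. r *\<^sub>R v)) (at 0)"
    by (auto intro!: derivative_eq_intros)
  moreover have "(f has_derivative f') (at (x + 0 *\<^sub>R v))" using assms by simp
  ultimately have "((\<lambda>t. f (x + t *\<^sub>R v)) has_derivative (\<lambda>r. f' (r *\<^sub>R v))) (at 0)"
    by (rule has_derivative_compose)
  moreover have "f' (r *\<^sub>R v) = f' v * r" for r
    using has_derivative_linear[OF assms] by (simp add: linear_cmul)
  ultimately show ?thesis by (simp add: has_field_derivative_def)
qed

lemma eventually_line:
  fixes x :: "'a::real_normed_vector"
  assumes "open S" "x \<in> S"
  shows "\<forall>\<^sub>F t in nhds 0. x + t *\<^sub>R v \<in> S"
proof -
  have "((\<lambda>t. x + t *\<^sub>R v) \<longlongrightarrow> x + 0 *\<^sub>R v) (nhds 0)"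
    by (intro tendsto_intros filterlim_ident)
  then show ?thesis using assms by (simp add: tendsto_def)
qed

section \<open>Randers metrics in a coordinate chart\<close>

text \<open>
  \<open>B x\<close> and \<open>l x\<close> are the coordinate expressions of the Riemannian metric and of the one-form on the
  coordinate domain \<open>S\<close>. The bound on \<open>l\<close> says that the one-form has norm less than 1, which makes \<open>F\<close>
  positive and its fundamental tensor definite. The
  curvature is formed from derivatives of order two.
\<close>

locale randers_chart =
  fixes S :: "(real ^ 'n::finite) set"
    and B :: "real ^ 'n \<Rightarrow> real ^ 'n \<Rightarrow> real ^ 'n \<Rightarrow> real"
    and l :: "real ^ 'n \<Rightarrow> real ^ 'n \<Rightarrow> real"
    and F :: "real ^ 'n \<Rightarrow> real ^ 'n \<Rightarrow> real"
  assumes open_S: "open S"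
    and F_eq: "\<And>x y. x \<in> S \<Longrightarrow> F x y = sqrt (B x y y) + l x y"
    and bilinear_B: "\<And>x. x \<in> S \<Longrightarrow> bilinear (B x)"
    and B_sym: "\<And>x u v. x \<in> S \<Longrightarrow> B x u v = B x v u"
    and B_pos: "\<And>x y. x \<in> S \<Longrightarrow> y \<noteq> 0 \<Longrightarrow> B x y y > 0"
    and linear_l: "\<And>x. x \<in> S \<Longrightarrow> linear (l x)"
    and l_less: "\<And>x y. x \<in> S \<Longrightarrow> y \<noteq> 0 \<Longrightarrow> \<bar>l x y\<bar> < sqrt (B x y y)"
    and C2_B: "\<And>u v. Ck_on 2 S (\<lambda>x. B x u v)"
    and C2_l: "\<And>v. Ck_on 2 S (\<lambda>x. l x v)"
begin

definition DB :: "real ^ 'n \<Rightarrow> real ^ 'n \<Rightarrow> real ^ 'n \<Rightarrow> real ^ 'n \<Rightarrow> real" where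
  "DB x w u v = frechet_derivative (\<lambda>x. B x u v) (at x) w"

definition Dl :: "real ^ 'n \<Rightarrow> real ^ 'n \<Rightarrow> real ^ 'n \<Rightarrow> real" where
  "Dl x w v = frechet_derivative (\<lambda>x. l x v) (at x) w"

lemma DB: "x \<in> S \<Longrightarrow> ((\<lambda>x. B x u v) has_derivative (\<lambda>w. DB x w u v)) (at x)"
  and Dl: "x \<in> S \<Longrightarrow> ((\<lambda>x. l x v) has_derivative (\<lambda>w. Dl x w v)) (at x)"
  using C2_B[of u v] C2_l[of v]
  by (simp_all add: numeral_2_eq_2 DB_def Dl_def frechet_derivative_works eta_contract_eq)

lemma B_add_left: "x \<in> S \<Longrightarrow> B x (u + v) w = B x u w + B x v w"
  and B_add_right: "x \<in> S \<Longrightarrow> B x w (u + v) = B x w u + B x w v"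
  and B_scale_left: "x \<in> S \<Longrightarrow> B x (r *\<^sub>R u) w = r * B x u w"
  and B_scale_right: "x \<in> S \<Longrightarrow> B x w (r *\<^sub>R u) = r * B x w u"
  and B_minus_left: "x \<in> S \<Longrightarrow> B x (- u) w = - B x u w"
  and B_minus_right: "x \<in> S \<Longrightarrow> B x w (- u) = - B x w u"
  and B_diff_left: "x \<in> S \<Longrightarrow> B x (u - v) w = B x u w - B x v w"
  and B_diff_right: "x \<in> S \<Longrightarrow> B x w (u - v) = B x w u - B x w v"
  using bilinear_B by (simp_all add: bilinear_ladd bilinear_radd bilinear_lmul bilinear_rmul
      bilinear_lneg bilinear_rneg bilinear_lsub bilinear_rsub)

lemmas B_simps = B_add_left B_add_right B_scale_left B_scale_right B_minus_left B_minus_right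
  B_diff_left B_diff_right

lemma l_simps:
  assumes "x \<in> S"
  shows "l x (u + v) = l x u + l x v" "l x (r *\<^sub>R u) = r * l x u" "l x (- u) = - l x u"
    "l x (u - v) = l x u - l x v"
  using linear_l[OF assms] by (simp_all add: linear_add linear_cmul linear_neg linear_diff)

lemma linear_DB: "x \<in> S \<Longrightarrow> linear (\<lambda>w. DB x w u v)"
  and linear_Dl: "x \<in> S \<Longrightarrow> linear (\<lambda>w. Dl x w v)"
  using DB Dl has_derivative_linear by blast+

lemma DB_eqI:
  assumes "x \<in> S" "((\<lambda>x. B x u v) has_derivative D) (at x)"
  shows "DB x w u v = D w"
  using has_derivative_unique[OF DB[OF assms(1)] assms(2)] by meson

text \<open>
  Identities between the values of \<open>B\<close> on \<open>S\<close> pass to its derivative; symmetry and bilinearity of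
  \<open>DB x w\<close> are obtained in this way.
\<close>

lemma DB_unique:
  assumes "x \<in> S" "(f has_derivative D) (at x)" "\<And>z. z \<in> S \<Longrightarrow> B z u v = f z"
  shows "DB x w u v = D w"
  by (rule DB_eqI[OF assms(1)])
     (rule has_derivative_transform_within_open[OF assms(2) open_S assms(1)], simp add: assms(3))

lemma Dl_unique:
  assumes "x \<in> S" "(f has_derivative D) (at x)" "\<And>z. z \<in> S \<Longrightarrow> l z v = f z"
  shows "Dl x w v = D w"
proof -
  have "((\<lambda>x. l x v) has_derivative D) (at x)"
    by (rule has_derivative_transform_within_open[OF assms(2) open_S assms(1)]) (simp add: assms(3))
  then show ?thesis
    using has_derivative_unique[OF Dl[OF assms(1)], of v D] by (simp add: fun_eq_iff)
qed

lemma DB_sym: "x \<in> S \<Longrightarrow> DB x w u v = DB x w v u"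
  by (rule DB_unique[OF _ DB]) (simp_all add: B_sym)

lemma DB_add: "x \<in> S \<Longrightarrow> DB x w (u + u') v = DB x w u v + DB x w u' v"
  by (rule DB_unique[OF _ has_derivative_add[OF DB DB]]) (simp_all add: B_simps)

lemma DB_scale: "x \<in> S \<Longrightarrow> DB x w (r *\<^sub>R u) v = r * DB x w u v"
  by (rule DB_unique[OF _ has_derivative_mult_right[OF DB]]) (simp_all add: B_simps)

lemma DB_simps:
  assumes "x \<in> S"
  shows "DB x w (u + u') v = DB x w u v + DB x w u' v" "DB x w v (u + u') = DB x w v u + DB x w v u'"
    "DB x w (r *\<^sub>R u) v = r * DB x w u v" "DB x w v (r *\<^sub>R u) = r * DB x w v u"
    "DB x w (- u) v = - DB x w u v" "DB x w v (- u) = - DB x w v u"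
    "DB x (w + w') u v = DB x w u v + DB x w' u v" "DB x (r *\<^sub>R w) u v = r * DB x w u v"
    "DB x (- w) u v = - DB x w u v"
  using assms DB_add[OF assms, of w u u' v] DB_scale[OF assms, of w r u v]
    DB_scale[OF assms, of w "-1" u v]
    DB_sym[OF assms, of w v "u + u'"] DB_sym[OF assms, of w v "r *\<^sub>R u"]
    DB_sym[OF assms, of w v "- u"] DB_sym[OF assms, of w v u] DB_sym[OF assms, of w v u']
    linear_add[OF linear_DB[OF assms, of u v], of w w'] linear_cmul[OF linear_DB[OF assms, of u v], of r w]
    linear_neg[OF linear_DB[OF assms, of u v], of w]
  by simp_all

lemma Dl_add: "x \<in> S \<Longrightarrow> Dl x w (u + u') = Dl x w u + Dl x w u'"
  by (rule Dl_unique[OF _ has_derivative_add[OF Dl Dl]]) (simp_all add: l_simps)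

lemma Dl_scale: "x \<in> S \<Longrightarrow> Dl x w (r *\<^sub>R u) = r * Dl x w u"
  by (rule Dl_unique[OF _ has_derivative_mult_right[OF Dl]]) (simp_all add: l_simps)

lemma Dl_simps:
  assumes "x \<in> S"
  shows "Dl x w (u + u') = Dl x w u + Dl x w u'" "Dl x w (r *\<^sub>R u) = r * Dl x w u"
    "Dl x w (- u) = - Dl x w u"
    "Dl x (w + w') u = Dl x w u + Dl x w' u" "Dl x (r *\<^sub>R w) u = r * Dl x w u"
    "Dl x (- w) u = - Dl x w u"
  using assms Dl_add[OF assms, of w u u'] Dl_scale[OF assms, of w r u]
    Dl_scale[OF assms, of w "-1" u] 
    linear_add[OF linear_Dl[OF assms, of u], of w w'] linear_cmul[OF linear_Dl[OF assms, of u], of r w]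
    linear_neg[OF linear_Dl[OF assms, of u], of w]
  by simp_all

definition \<alpha> :: "real ^ 'n \<Rightarrow> real ^ 'n \<Rightarrow> real" where
  "\<alpha> x y = sqrt (B x y y)"

definition F_y :: "real ^ 'n \<Rightarrow> real ^ 'n \<Rightarrow> real ^ 'n \<Rightarrow> real" where
  "F_y x y v = B x y v / \<alpha> x y + l x v"

text \<open>
  The Hessian of \<open>\<alpha> x\<close> on the tangent space.
\<close>

definition \<alpha>_yy :: "real ^ 'n \<Rightarrow> real ^ 'n \<Rightarrow> real ^ 'n \<Rightarrow> real ^ 'n \<Rightarrow> real" where
  "\<alpha>_yy x y u v = B x u v / \<alpha> x y - B x y u * B x y v / \<alpha> x y ^ 3"

text \<open>
  Half the Hessian of \<open>F\<^sup>2\<close>, by the product rule.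
\<close>

definition g :: "real ^ 'n \<Rightarrow> real ^ 'n \<Rightarrow> real ^ 'n \<Rightarrow> real ^ 'n \<Rightarrow> real" where
  "g x y u v = F_y x y u * F_y x y v + F x y * \<alpha>_yy x y u v"

definition F_x :: "real ^ 'n \<Rightarrow> real ^ 'n \<Rightarrow> real ^ 'n \<Rightarrow> real" where
  "F_x x y w = DB x w y y / (2 * \<alpha> x y) + Dl x w y"

definition F_xy :: "real ^ 'n \<Rightarrow> real ^ 'n \<Rightarrow> real ^ 'n \<Rightarrow> real ^ 'n \<Rightarrow> real" where
  "F_xy x y w v = DB x w y v / \<alpha> x y - DB x w y y * B x y v / (2 * \<alpha> x y ^ 3) + Dl x w v"

lemma \<alpha>_pos: "x \<in> S \<Longrightarrow> y \<noteq> 0 \<Longrightarrow> \<alpha> x y > 0"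
  using B_pos by (simp add: \<alpha>_def)

lemma \<alpha>_square: "x \<in> S \<Longrightarrow> y \<noteq> 0 \<Longrightarrow> \<alpha> x y * \<alpha> x y = B x y y"
  using B_pos by (simp add: \<alpha>_def order_less_imp_le)

lemma F_pos: "x \<in> S \<Longrightarrow> y \<noteq> 0 \<Longrightarrow> F x y > 0"
  using l_less[of x y] by (simp add: F_eq abs_less_iff)

lemma \<alpha>_deriv_y:
  assumes "x \<in> S" "y \<noteq> 0"
  shows "((\<lambda>t. \<alpha> x (y + t *\<^sub>R v)) has_real_derivative B x y v / \<alpha> x y) (at 0)"
proof -
  have "B x (y + t *\<^sub>R v) (y + t *\<^sub>R v) = B x y y + 2 * t * B x y v + t * t * B x v v" for t
    using assms(1) by (simp add: B_simps B_sym[of x v y] algebra_simps)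
  then have *: "\<alpha> x (y + t *\<^sub>R v) = sqrt (B x y y + 2 * t * B x y v + t * t * B x v v)" for t
    by (simp add: \<alpha>_def)
  show ?thesis
    unfolding * using B_pos[OF assms]
    by (auto intro!: derivative_eq_intros simp: \<alpha>_def field_simps)
qed

lemma F_deriv_y:
  assumes "x \<in> S" "y \<noteq> 0"
  shows "((\<lambda>t. F x (y + t *\<^sub>R v)) has_real_derivative F_y x y v) (at 0)"
proof -
  have "((\<lambda>t. \<alpha> x (y + t *\<^sub>R v) + (l x y + t * l x v)) has_real_derivative F_y x y v) (at 0)"
    by (auto intro!: derivative_eq_intros \<alpha>_deriv_y[OF assms] simp: F_y_def)
  then show ?thesis using assms by (simp add: F_eq \<alpha>_def l_simps)
qed

lemma F_y_deriv_y:
  assumes "x \<in> S" "y \<noteq> 0"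
  shows "((\<lambda>t. F_y x (y + t *\<^sub>R u) v) has_real_derivative \<alpha>_yy x y u v) (at 0)"
  unfolding F_y_def B_add_left[OF assms(1)] B_scale_left[OF assms(1)]
  using \<alpha>_pos[OF assms]
  by (auto intro!: derivative_eq_intros \<alpha>_deriv_y[OF assms]
      simp: \<alpha>_yy_def field_simps power3_eq_cube)

lemma F_deriv_x:
  assumes "x \<in> S" "y \<noteq> 0"
  shows "((\<lambda>t. F (x + t *\<^sub>R w) y) has_real_derivative F_x x y w) (at 0)"
proof -
  have "((\<lambda>t. sqrt (B (x + t *\<^sub>R w) y y) + l (x + t *\<^sub>R w) y) has_real_derivative F_x x y w) (at 0)"
    using B_pos[OF assms]
    by (auto intro!: derivative_eq_intros has_derivative_line[OF DB[OF assms(1)]]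
        has_derivative_line[OF Dl[OF assms(1)]] simp: F_x_def \<alpha>_def field_simps)
  moreover have "\<forall>\<^sub>F t in nhds 0. sqrt (B (x + t *\<^sub>R w) y y) + l (x + t *\<^sub>R w) y = F (x + t *\<^sub>R w) y"
    using eventually_line[OF open_S assms(1), of w] by eventually_elim (simp add: F_eq)
  ultimately show ?thesis
    by (subst (asm) DERIV_cong_ev[OF refl _ refl]) assumption+
qed

lemma F_x_deriv_y:
  assumes "x \<in> S" "y \<noteq> 0"
  shows "((\<lambda>t. F_x x (y + t *\<^sub>R v) w) has_real_derivative F_xy x y w v) (at 0)"
  unfolding F_x_def DB_simps[OF assms(1)] Dl_simps[OF assms(1)]
  using \<alpha>_pos[OF assms]
  by (auto intro!: derivative_eq_intros \<alpha>_deriv_y[OF assms]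
      simp: F_xy_def field_simps power3_eq_cube DB_sym[OF assms(1), of w v y])

lemma eventually_nonzero: "y \<noteq> 0 \<Longrightarrow> \<forall>\<^sub>F t in nhds 0. (y :: real ^ 'n) + t *\<^sub>R v \<noteq> 0"
  using eventually_line[of "- {0}" y v] by (simp add: open_Compl)

lemma partial_y_square:
  assumes "x \<in> S" "y \<noteq> 0"
  shows "partial_y k (\<lambda>x y. (F x y)\<^sup>2) x y = 2 * F x y * F_y x y (axis k 1)"
  unfolding partial_y_def
  by (rule DERIV_imp_deriv)
     (auto intro!: derivative_eq_intros F_deriv_y[OF assms] simp: assms)

lemma partial_x_square:
  assumes "x \<in> S" "y \<noteq> 0"
  shows "partial_x k (\<lambda>x y. (F x y)\<^sup>2) x y = 2 * F x y * F_x x y (axis k 1)"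
  unfolding partial_x_def
  by (rule DERIV_imp_deriv)
     (auto intro!: derivative_eq_intros F_deriv_x[OF assms] simp: assms)

lemma partial_y_partial_y_square:
  assumes "x \<in> S" "y \<noteq> 0"
  shows "partial_y i (partial_y j (\<lambda>x y. (F x y)\<^sup>2)) x y = 2 * g x y (axis i 1) (axis j 1)"
proof -
  have "deriv (\<lambda>t. partial_y j (\<lambda>x y. (F x y)\<^sup>2) x (y + t *\<^sub>R axis i 1)) 0 =
      deriv (\<lambda>t. 2 * F x (y + t *\<^sub>R axis i 1) * F_y x (y + t *\<^sub>R axis i 1) (axis j 1)) 0"
    by (intro deriv_cong_ev refl eventually_mono[OF eventually_nonzero[OF assms(2), of "axis i 1"]])
       (simp add: partial_y_square assms(1))
  also have "\<dots> = 2 * g x y (axis i 1) (axis j 1)"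
    by (rule DERIV_imp_deriv)
       (auto intro!: derivative_eq_intros F_deriv_y[OF assms] F_y_deriv_y[OF assms]
         simp: g_def algebra_simps)
  finally show ?thesis by (simp add: partial_y_def[of i])
qed

lemma partial_y_partial_x_square:
  assumes "x \<in> S" "y \<noteq> 0"
  shows "partial_y i (partial_x k (\<lambda>x y. (F x y)\<^sup>2)) x y =
    2 * (F_y x y (axis i 1) * F_x x y (axis k 1) + F x y * F_xy x y (axis k 1) (axis i 1))"
proof -
  have "deriv (\<lambda>t. partial_x k (\<lambda>x y. (F x y)\<^sup>2) x (y + t *\<^sub>R axis i 1)) 0 =
      deriv (\<lambda>t. 2 * F x (y + t *\<^sub>R axis i 1) * F_x x (y + t *\<^sub>R axis i 1) (axis k 1)) 0"
    by (intro deriv_cong_ev refl eventually_mono[OF eventually_nonzero[OF assms(2), of "axis i 1"]])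
       (simp add: partial_x_square assms(1))
  also have "\<dots> = 2 * (F_y x y (axis i 1) * F_x x y (axis k 1) + F x y * F_xy x y (axis k 1) (axis i 1))"
    by (rule DERIV_imp_deriv)
       (auto intro!: derivative_eq_intros F_deriv_y[OF assms] F_x_deriv_y[OF assms]
         simp: algebra_simps)
  finally show ?thesis by (simp add: partial_y_def[of i])
qed

lemma F_y_self: "x \<in> S \<Longrightarrow> y \<noteq> 0 \<Longrightarrow> F_y x y y = F x y"
  using \<alpha>_square[of x y] \<alpha>_pos[of x y]
  by (simp add: F_y_def F_eq \<alpha>_def[symmetric] field_simps)

lemma linear_F_y: "x \<in> S \<Longrightarrow> linear (F_y x y)"
  by (rule linearI) (simp_all add: F_y_def B_simps l_simps algebra_simps add_divide_distrib)

lemma linear_g_left: "x \<in> S \<Longrightarrow> linear (\<lambda>u. g x y u v)"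
  by (rule linearI) (simp_all add: g_def F_y_def \<alpha>_yy_def B_simps l_simps algebra_simps
      add_divide_distrib diff_divide_distrib)

lemma g_sym: "x \<in> S \<Longrightarrow> g x y u v = g x y v u"
  by (simp add: g_def F_y_def \<alpha>_yy_def B_sym[of x u v] algebra_simps)

lemma linear_g_right: "x \<in> S \<Longrightarrow> linear (g x y u)"
  using linear_g_left[of x y u] by (simp add: g_sym[of x y _ u] eta_contract_eq)

text \<open>
  Splitting off the component of \<open>u\<close> along \<open>y\<close>, with orthogonal remainder \<open>z\<close>, turns the form into
  \<open>(F_y u)\<^sup>2 + F / \<alpha> * B(z, z)\<close>. If \<open>z\<close> vanishes, \<open>u\<close> is a multiple of \<open>y\<close>, where \<open>F_y\<close> is not zero by
  homogeneity.
\<close>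

lemma g_pos:
  assumes "x \<in> S" "y \<noteq> 0" "u \<noteq> 0"
  shows "g x y u u > 0"
proof -
  define t where "t = B x y u / B x y y"
  define z where "z = u - t *\<^sub>R y"
  have \<alpha>: "\<alpha> x y > 0" "F x y > 0" "B x y y = \<alpha> x y * \<alpha> x y"
    using \<alpha>_pos F_pos \<alpha>_square assms by auto
  have "\<alpha>_yy x y u u = B x z z / \<alpha> x y"
    using assms(1) \<alpha>
    by (simp add: \<alpha>_yy_def z_def t_def B_simps B_sym[of x u y] field_simps power3_eq_cube)
  then have g: "g x y u u = (F_y x y u)\<^sup>2 + F x y * (B x z z / \<alpha> x y)"
    by (simp add: g_def power2_eq_square)
  show ?thesis
  proof (cases "z = 0")
    case False
    then have "F x y * (B x z z / \<alpha> x y) > 0" using \<alpha> B_pos assms(1) by simp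
    then show ?thesis unfolding g by (simp add: add_nonneg_pos)
  next
    case True
    then have u: "u = t *\<^sub>R y" by (simp add: z_def)
    with assms(3) have "t \<noteq> 0" by auto
    have "F_y x y u = t * F x y"
      using linear_F_y[OF assms(1), of y] F_y_self[OF assms(1,2)] u by (simp add: linear_cmul)
    then have "(F_y x y u)\<^sup>2 > 0" using \<open>t \<noteq> 0\<close> \<alpha> by simp
    moreover have "B x z z = 0" using True bilinear_B[OF assms(1)] by (simp add: bilinear_lzero)
    ultimately show ?thesis unfolding g by simp
  qed
qed

lemma fundamental_tensor_eq:
  assumes "x \<in> S" "y \<noteq> 0"
  shows "fundamental_tensor F x y $ i $ j = g x y (axis i 1) (axis j 1)"
  using partial_y_partial_y_square[OF assms] by (simp add: fundamental_tensor_def)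

lemma fundamental_form_eq:
  assumes "x \<in> S" "y \<noteq> 0"
  shows "fundamental_form F x y u v = g x y u v"
proof -
  have "fundamental_form F x y u v =
      (\<Sum>i\<in>UNIV. u $ i *\<^sub>R (\<Sum>j\<in>UNIV. v $ j *\<^sub>R g x y (axis i 1) (axis j 1)))"
    by (simp add: fundamental_form_def fundamental_tensor_eq[OF assms] sum_distrib_left mult_ac)
  also have "\<dots> = g x y u v"
    by (simp only: linear_sum_axis[OF linear_g_right[OF assms(1)]]
        linear_sum_axis[OF linear_g_left[OF assms(1)]])
  finally show ?thesis .
qed

lemma invertible_fundamental_tensor:
  assumes "x \<in> S" "y \<noteq> 0"
  shows "invertible (fundamental_tensor F x y)"
proof -
  have "w = 0" if w: "fundamental_tensor F x y *v w = 0" for w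
  proof (rule ccontr)
    assume "w \<noteq> 0"
    have "fundamental_form F x y w w = w \<bullet> (fundamental_tensor F x y *v w)"
      by (simp add: fundamental_form_def inner_vec_def matrix_vector_mult_def sum_distrib_left mult_ac)
    then show False
      using g_pos[OF assms \<open>w \<noteq> 0\<close>] w by (simp add: fundamental_form_eq[OF assms])
  qed
  then show ?thesis
    by (metis invertible_left_inverse matrix_left_invertible_ker)
qed

text \<open>
  The spray coefficients are defined by a linear system whose matrix is the fundamental tensor. Because
  that matrix is invertible, the spray is the only solution, so that a formula for the spray can be both
  exploited and verified without inverting anything.
\<close>

lemma spray_eq_iff:
  assumes "x \<in> S" "y \<noteq> 0"
  shows "(\<chi> i. spray F i x y) = w \<longleftrightarrow>
    (\<forall>v. 2 * g x y v w = F_y x y v * F_x x y y + F x y * (F_xy x y y v - F_x x y v))"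
proof -
  let ?M = "fundamental_tensor F x y"
  let ?c = "\<lambda>v. 1/2 * (F_y x y v * F_x x y y + F x y * (F_xy x y y v - F_x x y v))"
  have lin_x: "linear (F_x x y)"
    using assms(1) by (intro linearI) (simp_all add: F_x_def DB_simps Dl_simps field_simps add_divide_distrib)
  have lin_xy: "linear (\<lambda>w. F_xy x y w v)" for v
    using assms(1) by (intro linearI)
      (simp_all add: F_xy_def DB_simps Dl_simps field_simps add_divide_distrib diff_divide_distrib)
  have lin_xy': "linear (F_xy x y w)" for w
    using assms(1) by (intro linearI)
      (simp_all add: F_xy_def DB_simps Dl_simps B_simps field_simps add_divide_distrib diff_divide_distrib)
  have lin_c: "linear ?c"
    using assms(1) linear_F_y[OF assms(1), of y] lin_xy'[of y] lin_x
    by (intro linearI) (simp_all add: linear_add linear_cmul algebra_simps)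
  have sum1: "(\<Sum>k\<in>UNIV. 2 * (a * F_x x y (axis k 1) + b * F_xy x y (axis k 1) v) * y $ k) =
      2 * (a * F_x x y y + b * F_xy x y y v)" for a b v
  proof -
    have lin: "linear (\<lambda>w. 2 * (a * F_x x y w + b * F_xy x y w v))"
      using lin_x by (intro linearI)
        (simp_all add: linear_add[OF lin_xy] linear_cmul[OF lin_xy] linear_add linear_cmul algebra_simps)
    from linear_sum_axis[OF this, of y] show ?thesis by (simp add: mult.commute)
  qed
  have c: "1/4 * ((\<Sum>k\<in>UNIV. partial_y j (partial_x k (\<lambda>x y. (F x y)\<^sup>2)) x y * y $ k)
       - partial_x j (\<lambda>x y. (F x y)\<^sup>2) x y) = ?c (axis j 1)" for j
    by (simp only: partial_y_partial_x_square[OF assms] partial_x_square[OF assms] sum1)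
       (simp add: field_simps)
  have "spray F i x y = (\<Sum>j\<in>UNIV. matrix_inv ?M $ i $ j * ?c (axis j 1))" for i
    unfolding c[symmetric] spray_def sum_distrib_left[of "1/4"] by (simp only: mult.left_commute)
  then have spray: "(\<chi> i. spray F i x y) = matrix_inv ?M *v (\<chi> j. ?c (axis j 1))"
    by (simp add: vec_eq_iff matrix_vector_mult_def)
  have inv: "matrix_inv ?M ** ?M = mat 1" "?M ** matrix_inv ?M = mat 1"
    using invertible_fundamental_tensor[OF assms] someI_ex[of "\<lambda>A'. ?M ** A' = mat 1 \<and> A' ** ?M = mat 1"]
    by (simp_all add: invertible_def matrix_inv_def)
  have "(\<chi> i. spray F i x y) = w \<longleftrightarrow> ?M *v w = (\<chi> j. ?c (axis j 1))"
  proof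
    assume "(\<chi> i. spray F i x y) = w"
    then have "w = matrix_inv ?M *v (\<chi> j. ?c (axis j 1))" by (simp only: spray)
    then show "?M *v w = (\<chi> j. ?c (axis j 1))"
      by (simp only: matrix_vector_mul_assoc inv matrix_vector_mul_lid)
  next
    assume "?M *v w = (\<chi> j. ?c (axis j 1))"
    then have "matrix_inv ?M *v (?M *v w) = (\<chi> i. spray F i x y)" by (simp only: spray)
    then show "(\<chi> i. spray F i x y) = w"
      by (simp only: matrix_vector_mul_assoc inv matrix_vector_mul_lid)
  qed
  also have "\<dots> \<longleftrightarrow> (\<forall>j. g x y (axis j 1) w = ?c (axis j 1))"
  proof -
    have "(?M *v w) $ j = g x y (axis j 1) w" for j
      using linear_sum_axis[OF linear_g_right[OF assms(1)], of w y "axis j 1"]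
      by (simp add: matrix_vector_mult_def fundamental_tensor_eq[OF assms] mult.commute)
    then show ?thesis by (simp add: vec_eq_iff)
  qed
  also have "\<dots> \<longleftrightarrow> (\<forall>v. g x y v w = ?c v)"
  proof (intro iffI allI)
    fix v assume *: "\<forall>j. g x y (axis j 1) w = ?c (axis j 1)"
    have "g x y v w = (\<Sum>k\<in>UNIV. v $ k *\<^sub>R g x y (axis k 1) w)"
      by (rule linear_sum_axis[OF linear_g_left[OF assms(1)], symmetric])
    also have "\<dots> = (\<Sum>k\<in>UNIV. v $ k *\<^sub>R ?c (axis k 1))"
      by (intro sum.cong refl) (simp only: *[rule_format])
    also have "\<dots> = ?c v" by (rule linear_sum_axis[OF lin_c])
    finally show "g x y v w = ?c v" .
  qed simp
  finally show ?thesis by (simp add: field_simps)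
qed

end

section \<open>Quadratic sprays and parallel forms\<close>

context randers_chart
begin

text \<open>
  Both forms have vanishing covariant derivative for the connection with Christoffel symbols \<open>\<Gamma>\<close>.
\<close>

definition parallel :: "(real ^ 'n \<Rightarrow> real ^ 'n \<Rightarrow> real ^ 'n \<Rightarrow> real ^ 'n) \<Rightarrow> bool" where
  "parallel \<Gamma> \<longleftrightarrow> (\<forall>x\<in>S.
     (\<forall>w u v. DB x w u v = B x (\<Gamma> x w u) v + B x u (\<Gamma> x w v)) \<and>
     (\<forall>w v. Dl x w v = l x (\<Gamma> x w v)))"

lemma F_xy_self:
  assumes "x \<in> S" "y \<noteq> 0"
  shows "F_xy x y w y = F_x x y w"
  using \<alpha>_pos[OF assms] \<alpha>_square[OF assms, symmetric]
  by (simp add: F_xy_def F_x_def field_simps power3_eq_cube)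

lemma \<alpha>_yy_self:
  assumes "x \<in> S" "y \<noteq> 0"
  shows "\<alpha>_yy x y y v = 0"
  using \<alpha>_pos[OF assms] \<alpha>_square[OF assms, symmetric]
  by (simp add: \<alpha>_yy_def field_simps power3_eq_cube)

lemma \<alpha>_minus: "x \<in> S \<Longrightarrow> \<alpha> x (- y) = \<alpha> x y"
  by (simp add: \<alpha>_def B_simps)

text \<open>
  The parity argument. Evaluating the spray equation at \<open>v = y\<close> gives an identity whose terms with \<open>B\<close>
  are odd in \<open>y\<close> and whose terms with \<open>l\<close> are even, so the two groups agree separately. Inserting this into
  the equation for general \<open>v\<close> leaves terms with a factor \<open>1 / \<alpha>\<close>, which are even, and the terms with
  \<open>Dl\<close>, which are odd; again they separate. The second conclusion is the diagonal case of the Christoffel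
  formula, the third says that the one-form is closed.
\<close>

lemma quadratic_spray_diagonal:
  assumes x: "x \<in> S" and y: "y \<noteq> 0"
    and spray: "\<And>y. y \<noteq> 0 \<Longrightarrow> (\<chi> i. spray F i x y) = (1/2) *\<^sub>R W y"
    and even: "W (- y) = W y"
  shows "l x (W y) = Dl x y y"
    and "B x v (W y) = DB x y y v - DB x v y y / 2"
    and "Dl x y v = Dl x v y"
proof -
  have eq: "g x z v (W z) = F_y x z v * F_x x z z + F x z * (F_xy x z z v - F_x x z v)"
    if "z \<noteq> 0" for z v
    using iffD1[OF spray_eq_iff[OF x that] spray[OF that]]
    by (simp add: linear_cmul[OF linear_g_right[OF x]])
  have I: "F_y x z (W z) = F_x x z z" if "z \<noteq> 0" for z
    using eq[OF that, of z] F_pos[OF x that]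
    by (simp add: g_def \<alpha>_yy_self[OF x that] F_y_self[OF x that] F_xy_self[OF x that])
  have II: "\<alpha>_yy x z v (W z) = F_xy x z z v - F_x x z v" if "z \<noteq> 0" for z v
    using eq[OF that, of v] F_pos[OF x that] I[OF that] by (simp add: g_def)
  have "- y \<noteq> 0" using y by simp
  note a = \<alpha>_pos[OF x y]
  have "B x y (W y) / \<alpha> x y + l x (W y) = DB x y y y / (2 * \<alpha> x y) + Dl x y y"
    using I[OF y] by (simp add: F_y_def F_x_def)
  moreover have "- (B x y (W y) / \<alpha> x y) + l x (W y) = - (DB x y y y / (2 * \<alpha> x y)) + Dl x y y"
    using I[OF \<open>- y \<noteq> 0\<close>] x
    by (simp add: F_y_def F_x_def even \<alpha>_minus B_simps DB_simps Dl_simps l_simps)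
  ultimately have l: "l x (W y) = Dl x y y"
    and "B x y (W y) / \<alpha> x y = DB x y y y / (2 * \<alpha> x y)"
    by linarith+
  then have B: "B x y (W y) = DB x y y y / 2" using a by (simp add: field_simps)
  show "l x (W y) = Dl x y y" by (rule l)
  have "B x v (W y) / \<alpha> x y = DB x y y v / \<alpha> x y - DB x v y y / (2 * \<alpha> x y) + (Dl x y v - Dl x v y)"
    using II[OF y, of v] by (simp add: \<alpha>_yy_def F_xy_def F_x_def B mult.commute[of "B x y v"])
  moreover have "B x v (W y) / \<alpha> x y = DB x y y v / \<alpha> x y - DB x v y y / (2 * \<alpha> x y) - (Dl x y v - Dl x v y)"
    using II[OF \<open>- y \<noteq> 0\<close>, of v] x
    by (simp add: \<alpha>_yy_def F_xy_def F_x_def even \<alpha>_minus B_simps DB_simps Dl_simps l_simps B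
        mult.commute[of "B x y v"])
  ultimately have "B x v (W y) / \<alpha> x y = DB x y y v / \<alpha> x y - DB x v y y / (2 * \<alpha> x y)"
    and "Dl x y v = Dl x v y"
    by linarith+
  then show "B x v (W y) = DB x y y v - DB x v y y / 2" and "Dl x y v = Dl x v y"
    using a by (simp_all add: field_simps)
qed

text \<open>
  Polarizing the diagonal identities gives the Christoffel formula for \<open>B\<close>, which is equivalent to
  \<open>B\<close> being parallel, and the symmetric part of the covariant derivative of \<open>l\<close>; the skew part vanishes
  because \<open>l\<close> is closed.
\<close>

lemma quadratic_spray_imp_parallel:
  assumes spray: "\<And>x y. x \<in> S \<Longrightarrow> y \<noteq> 0 \<Longrightarrow> (\<chi> i. spray F i x y) = (1/2) *\<^sub>R \<Gamma> x y y"
    and \<Gamma>: "\<And>x. x \<in> S \<Longrightarrow> bilinear (\<Gamma> x)" and sym: "\<And>x u v. x \<in> S \<Longrightarrow> \<Gamma> x u v = \<Gamma> x v u"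
  shows "parallel \<Gamma>"
  unfolding parallel_def
proof (intro ballI conjI allI)
  fix x assume x: "x \<in> S"
  have even: "\<Gamma> x (- y) (- y) = \<Gamma> x y y" for y
    using \<Gamma>[OF x] by (simp add: bilinear_lneg bilinear_rneg)
  have zero: "\<Gamma> x 0 0 = 0" "B x v 0 = 0" "DB x 0 0 v = 0" "DB x v 0 0 = 0" "l x 0 = 0" "Dl x 0 v = 0"
    "Dl x v 0 = 0" for v
    using \<Gamma>[OF x] bilinear_B[OF x] linear_l[OF x] DB_scale[OF x, of v 0 0 0] Dl_scale[OF x, of v 0 0]
      linear_0[OF linear_DB[OF x]] linear_0[OF linear_Dl[OF x]]
    by (simp_all add: bilinear_lzero bilinear_rzero linear_0)
  have l: "l x (\<Gamma> x y y) = Dl x y y" and B: "B x v (\<Gamma> x y y) = DB x y y v - DB x v y y / 2"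
    and closed: "Dl x y v = Dl x v y" for y v
    by (cases "y = 0", simp_all only: zero diff_0_right div_0 quadratic_spray_diagonal[OF x _ spray[OF x] even]
        not_False_eq_True)+
  have exp: "\<Gamma> x (u + w) (u + w) = \<Gamma> x u u + 2 *\<^sub>R \<Gamma> x u w + \<Gamma> x w w" for u w
    using \<Gamma>[OF x] sym[OF x, of w u] by (simp add: bilinear_ladd bilinear_radd scaleR_2)
  have l2: "l x (\<Gamma> x u w) = Dl x u w" for u w
    using l[of "u + w"] l[of u] l[of w] closed[of u w] x
    by (simp add: exp l_simps Dl_simps)
  have B2: "2 * B x v (\<Gamma> x u w) = DB x u w v + DB x w u v - DB x v u w" for u v w
    using B[of v "u + w"] B[of v u] B[of v w] DB_sym[OF x, of v w u] x
    by (simp add: exp B_simps DB_simps field_simps)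
  show "Dl x w v = l x (\<Gamma> x w v)" for w v using l2 by simp
  show "DB x w u v = B x (\<Gamma> x w u) v + B x u (\<Gamma> x w v)" for w u v
    using B2[of v w u] B2[of u w v] B_sym[OF x, of "\<Gamma> x w u" v]
      DB_sym[OF x, of w u v] DB_sym[OF x, of u w v] DB_sym[OF x, of v w u]
    by simp
qed

text \<open>
  When both forms are parallel, all horizontal derivatives in the spray equation can be replaced by
  values of \<open>\<Gamma>\<close>, and the terms match.
\<close>

lemma parallel_imp_quadratic_spray:
  assumes par: "parallel \<Gamma>" and x: "x \<in> S" and y: "y \<noteq> 0"
    and sym: "\<And>u v. \<Gamma> x u v = \<Gamma> x v u"
  shows "(\<chi> i. spray F i x y) = (1/2) *\<^sub>R \<Gamma> x y y"
proof -
  have DB: "DB x w u v = B x (\<Gamma> x w u) v + B x u (\<Gamma> x w v)" and Dl: "Dl x w v = l x (\<Gamma> x w v)"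
    for w u v using par x by (auto simp: parallel_def)
  note a = \<alpha>_pos[OF x y]
  have F_y: "F_y x y (\<Gamma> x y y) = F_x x y y"
    using a B_sym[OF x] by (simp add: F_y_def F_x_def DB Dl)
  have "\<alpha>_yy x y v (\<Gamma> x y y) = F_xy x y y v - F_x x y v" for v
    using a B_sym[OF x, of "\<Gamma> x y y" y] B_sym[OF x, of "\<Gamma> x y y" v] B_sym[OF x, of "\<Gamma> x v y" y]
    by (simp add: \<alpha>_yy_def F_xy_def F_x_def DB Dl sym[of v y] add_divide_distrib)
  then have "2 * g x y v ((1/2) *\<^sub>R \<Gamma> x y y) =
      F_y x y v * F_x x y y + F x y * (F_xy x y y v - F_x x y v)" for v
    unfolding linear_cmul[OF linear_g_right[OF x]] by (simp add: g_def F_y)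
  then show ?thesis using spray_eq_iff[OF x y] by blast
qed

end

section \<open>Curvature of a quadratic spray\<close>

lemma differentiable_prod:
  fixes f :: "'i \<Rightarrow> 'a::real_normed_vector \<Rightarrow> real"
  assumes "\<And>i. i \<in> I \<Longrightarrow> f i differentiable (at x)"
  shows "(\<lambda>x. \<Prod>i\<in>I. f i x) differentiable (at x)"
  using assms by (induction I rule: infinite_finite_induct) auto

lemma differentiable_det:
  fixes M :: "'a::real_normed_vector \<Rightarrow> real ^ 'n ^ 'n"
  assumes "\<And>i j. (\<lambda>z. M z $ i $ j) differentiable (at x)"
  shows "(\<lambda>z. det (M z)) differentiable (at x)"
  unfolding det_def
  by (intro differentiable_sum ballI differentiable_mult differentiable_const differentiable_prod
      assms) (simp add: finite_permutations)

text \<open>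
  By Cramer's rule the solution is a quotient of determinants, which are polynomials in the entries.
\<close>

lemma linear_system_differentiable:
  fixes M :: "'a::real_normed_vector \<Rightarrow> real ^ 'n ^ 'n"
  assumes S: "open S" "x \<in> S"
    and M: "\<And>i j. (\<lambda>z. M z $ i $ j) differentiable (at x)"
    and c: "\<And>i. (\<lambda>z. c z $ i) differentiable (at x)"
    and det: "\<And>z. z \<in> S \<Longrightarrow> det (M z) \<noteq> 0"
    and f: "\<And>z. z \<in> S \<Longrightarrow> M z *v f z = c z"
  shows "f differentiable (at x)"
proof -
  let ?h = "\<lambda>z k. det (\<chi> i j. if j = k then c z $ i else M z $ i $ j) / det (M z)"
  have h: "f z = (\<chi> k. ?h z k)" if "z \<in> S" for z
    using cramer[OF det[OF that]] f[OF that] by blast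
  have "(\<lambda>z. ?h z k) differentiable (at x)" for k
  proof (intro differentiable_divide differentiable_det M det S)
    show "(\<lambda>z. (\<chi> i j. if j = k then c z $ i else M z $ i $ j) $ i $ j) differentiable (at x)" for i j
      by (cases "j = k") (simp_all add: M c)
  qed
  then have "(\<lambda>z. f z \<bullet> axis k 1) differentiable (at x)" for k
  proof -
    obtain D where "((\<lambda>z. ?h z k) has_derivative D) (at x)"
      using \<open>(\<lambda>z. ?h z k) differentiable (at x)\<close> by (auto simp: differentiable_def)
    from has_derivative_transform_within_open[OF this S, of "\<lambda>z. f z \<bullet> axis k 1"]
    show ?thesis by (auto simp: differentiable_def h inner_axis)
  qed
  then show ?thesis
    by (subst differentiable_componentwise_within) (auto simp: Basis_vec_def)
qed

text \<open>
  For \<open>G = 1/2 \<Gamma>(y, y)\<close> the four terms of the curvature coefficients assemble to the curvature tensor of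
  \<open>\<Gamma>\<close>, in the form \<open>R(u, y)y\<close>. Only \<open>\<Gamma>\<close> enters on the right, so Finsler metrics with the same spray
  have the same Riemann curvature.
\<close>

lemma riemann_curvature_quadratic_spray:
  fixes F :: "real ^ 'n::finite \<Rightarrow> real ^ 'n \<Rightarrow> real"
  assumes S: "open S" "x \<in> S" and y: "y \<noteq> 0"
    and spray: "\<And>z y. z \<in> S \<Longrightarrow> y \<noteq> 0 \<Longrightarrow> (\<chi> i. spray F i z y) = (1/2) *\<^sub>R \<Gamma> z y y"
    and \<Gamma>: "\<And>z. z \<in> S \<Longrightarrow> bilinear (\<Gamma> z)" and sym: "\<And>z u v. z \<in> S \<Longrightarrow> \<Gamma> z u v = \<Gamma> z v u"
    and D\<Gamma>: "\<And>u v. ((\<lambda>z. \<Gamma> z u v) has_derivative (\<lambda>w. D\<Gamma> w u v)) (at x)"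
  shows "riemann_curvature F x y u =
    D\<Gamma> u y y + \<Gamma> x u (\<Gamma> x y y) - D\<Gamma> y u y - \<Gamma> x y (\<Gamma> x u y)"
proof -
  have spray': "spray F i z y = 1/2 * \<Gamma> z y y $ i" if "z \<in> S" "y \<noteq> 0" for i z y
    using arg_cong[OF spray[OF that], of "\<lambda>v. v $ i"] by simp
  have \<Gamma>_simps: "\<Gamma> z (u + u') v = \<Gamma> z u v + \<Gamma> z u' v" "\<Gamma> z v (u + u') = \<Gamma> z v u + \<Gamma> z v u'"
    "\<Gamma> z (r *\<^sub>R u) v = r *\<^sub>R \<Gamma> z u v" "\<Gamma> z v (r *\<^sub>R u) = r *\<^sub>R \<Gamma> z v u" if "z \<in> S" for z u u' v r
    using \<Gamma>[OF that] by (simp_all add: bilinear_ladd bilinear_radd bilinear_lmul bilinear_rmul)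
  have nz: "\<forall>\<^sub>F t in nhds 0. y + t *\<^sub>R v \<noteq> 0" if "y \<noteq> 0" for y v :: "real ^ 'n"
    using eventually_line[of "- {0}" y v] that by (simp add: open_Compl)
  have comp: "((\<lambda>z. \<Gamma> z u v $ i) has_derivative (\<lambda>w. D\<Gamma> w u v $ i)) (at x)" for u v i
    by (rule bounded_linear.has_derivative[OF bounded_linear_vec_nth D\<Gamma>])
  have N: "partial_y k (spray F i) z y = \<Gamma> z (axis k 1) y $ i" if "z \<in> S" "y \<noteq> 0" for k i z y
  proof -
    have "partial_y k (spray F i) z y =
        deriv (\<lambda>t. 1/2 * (\<Gamma> z y y $ i + 2 * t * \<Gamma> z (axis k 1) y $ i
          + t * t * \<Gamma> z (axis k 1) (axis k 1) $ i)) 0"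
      unfolding partial_y_def
      using sym[OF that(1), of y "axis k 1"]
      by (intro deriv_cong_ev refl eventually_mono[OF nz[OF that(2), of "axis k 1"]])
         (simp add: spray' that(1) \<Gamma>_simps algebra_simps)
    also have "\<dots> = \<Gamma> z (axis k 1) y $ i"
      by (rule DERIV_imp_deriv) (auto intro!: derivative_eq_intros)
    finally show ?thesis .
  qed
  have NN: "partial_y j (partial_y k (spray F i)) x y = \<Gamma> x (axis k 1) (axis j 1) $ i" for i j k
  proof -
    have "partial_y j (partial_y k (spray F i)) x y =
        deriv (\<lambda>t. \<Gamma> x (axis k 1) y $ i + t * \<Gamma> x (axis k 1) (axis j 1) $ i) 0"
      unfolding partial_y_def[of j]
      by (intro deriv_cong_ev refl eventually_mono[OF nz[OF y, of "axis j 1"]])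
         (simp add: N S \<Gamma>_simps)
    also have "\<dots> = \<Gamma> x (axis k 1) (axis j 1) $ i"
      by (rule DERIV_imp_deriv) (auto intro!: derivative_eq_intros)
    finally show ?thesis .
  qed
  have DG: "partial_x k (spray F i) x y = 1/2 * D\<Gamma> (axis k 1) y y $ i" for i k
  proof -
    have "partial_x k (spray F i) x y = deriv (\<lambda>t. 1/2 * \<Gamma> (x + t *\<^sub>R axis k 1) y y $ i) 0"
      unfolding partial_x_def
      by (intro deriv_cong_ev refl eventually_mono[OF eventually_line[OF S, of "axis k 1"]])
         (simp add: spray' y)
    also have "\<dots> = 1/2 * D\<Gamma> (axis k 1) y y $ i"
      by (intro DERIV_imp_deriv DERIV_cmult has_derivative_line[OF comp])
    finally show ?thesis .
  qed
  have DN: "partial_x j (partial_y k (spray F i)) x y = D\<Gamma> (axis j 1) (axis k 1) y $ i" for i j k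
  proof -
    have "partial_x j (partial_y k (spray F i)) x y =
        deriv (\<lambda>t. \<Gamma> (x + t *\<^sub>R axis j 1) (axis k 1) y $ i) 0"
      unfolding partial_x_def
      by (intro deriv_cong_ev refl eventually_mono[OF eventually_line[OF S, of "axis j 1"]])
         (simp add: N y)
    also have "\<dots> = D\<Gamma> (axis j 1) (axis k 1) y $ i"
      by (intro DERIV_imp_deriv has_derivative_line[OF comp])
    finally show ?thesis .
  qed
  have lin_D: "linear (\<lambda>w. D\<Gamma> w u v)" for u v
    using D\<Gamma> has_derivative_linear by blast
  have D_unique: "D\<Gamma> w u v = D w"
    if "(f has_derivative D) (at x)" "\<And>z. z \<in> S \<Longrightarrow> \<Gamma> z u v = f z" for f D u v w
  proof -
    have "((\<lambda>z. \<Gamma> z u v) has_derivative D) (at x)"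
      by (rule has_derivative_transform_within_open[OF that(1) S]) (simp add: that(2))
    then show ?thesis using has_derivative_unique[OF D\<Gamma>, of u v D] by (simp add: fun_eq_iff)
  qed
  have lin_D2: "linear (\<lambda>u. D\<Gamma> w u v)" for w v
  proof (rule linearI)
    show "D\<Gamma> w (u + u') v = D\<Gamma> w u v + D\<Gamma> w u' v" for u u'
      by (rule D_unique[OF has_derivative_add[OF D\<Gamma> D\<Gamma>]]) (simp add: \<Gamma>_simps)
    show "D\<Gamma> w (r *\<^sub>R u) v = r *\<^sub>R D\<Gamma> w u v" for r u
      by (rule D_unique[OF has_derivative_scaleR_right[OF D\<Gamma>]]) (simp add: \<Gamma>_simps)
  qed
  have lin_\<Gamma>: "linear (\<Gamma> x v)" "linear (\<lambda>u. \<Gamma> x u v)" for v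
    using S(2) by (auto intro!: linearI simp: \<Gamma>_simps)
  let ?R = "\<lambda>u. D\<Gamma> u y y - D\<Gamma> y u y + \<Gamma> x u (\<Gamma> x y y) - \<Gamma> x y (\<Gamma> x u y)"
  have coeff: "riemann_coeff F i k x y = ?R (axis k 1) $ i" for i k
  proof -
    have "riemann_coeff F i k x y = D\<Gamma> (axis k 1) y y $ i
        - (\<Sum>j\<in>UNIV. y $ j *\<^sub>R D\<Gamma> (axis j 1) (axis k 1) y) $ i
        + (\<Sum>j\<in>UNIV. \<Gamma> x y y $ j *\<^sub>R \<Gamma> x (axis k 1) (axis j 1)) $ i
        - (\<Sum>j\<in>UNIV. \<Gamma> x (axis k 1) y $ j *\<^sub>R \<Gamma> x (axis j 1) y) $ i"
      unfolding riemann_coeff_def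
      by (simp add: DG DN NN N[OF S(2) y] spray'[OF S(2) y] sum_distrib_left mult_ac)
    then show ?thesis
      by (simp add: linear_sum_axis[OF lin_D] linear_sum_axis[OF lin_\<Gamma>(1)]
          linear_sum_axis[OF lin_\<Gamma>(2)] sym[OF S(2), of "\<Gamma> x (axis k 1) y" y])
  qed
  have lin_R: "linear ?R"
    using S(2) by (intro linearI) (simp_all add: linear_add[OF lin_D] linear_add[OF lin_D2]
      linear_cmul[OF lin_D] linear_cmul[OF lin_D2] \<Gamma>_simps algebra_simps)
  have "riemann_curvature F x y u = (\<Sum>k\<in>UNIV. u $ k *\<^sub>R ?R (axis k 1))"
    unfolding riemann_curvature_def vec_eq_iff
    by (simp add: coeff mult.commute)
  also have "\<dots> = ?R u" by (rule linear_sum_axis[OF lin_R])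
  finally show ?thesis by simp
qed

context randers_chart
begin

lemma DB_differentiable: "x \<in> S \<Longrightarrow> (\<lambda>z. DB z w u v) differentiable (at x)"
  using C2_B[of u v] by (simp add: numeral_2_eq_2 DB_def)

lemma DB_second_symmetric: "x \<in> S \<Longrightarrow>
    frechet_derivative (\<lambda>z. DB z u v v') (at x) w = frechet_derivative (\<lambda>z. DB z w v v') (at x) u"
  and Dl_second_symmetric: "x \<in> S \<Longrightarrow>
    frechet_derivative (\<lambda>z. Dl z u v) (at x) w = frechet_derivative (\<lambda>z. Dl z w v) (at x) u"
  unfolding DB_def Dl_def
  by (rule Ck_on_second_derivative_symmetric[OF open_S _ C2_B],
      (rule Ck_on_second_derivative_symmetric[OF open_S _ C2_l] | assumption)+)

text \<open>
  The Christoffel formula is a linear system for \<open>\<Gamma> z u v\<close> with the invertible matrix of \<open>B z\<close> and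
  differentiable data.
\<close>

lemma parallel_differentiable:
  assumes par: "parallel \<Gamma>" and sym: "\<And>z u v. z \<in> S \<Longrightarrow> \<Gamma> z u v = \<Gamma> z v u" and x: "x \<in> S"
  shows "(\<lambda>z. \<Gamma> z u v) differentiable (at x)"
proof (rule linear_system_differentiable[OF open_S x])
  let ?M = "\<lambda>z. \<chi> i j. B z (axis i 1) (axis j 1)"
  let ?c = "\<lambda>z. \<chi> i. 1/2 * (DB z u v (axis i 1) + DB z v u (axis i 1) - DB z (axis i 1) u v)"
  show "(\<lambda>z. ?M z $ i $ j) differentiable (at x)" for i j
    using DB[OF x] by (auto simp: differentiable_def)
  show "(\<lambda>z. ?c z $ i) differentiable (at x)" for i
    using x by (auto intro!: differentiable_divide differentiable_add differentiable_diff DB_differentiable)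
  fix z assume z: "z \<in> S"
  have M: "(?M z *v w) $ i = B z (axis i 1) w" for w i
  proof -
    have "linear (B z (axis i 1))" using bilinear_B[OF z] by (simp add: bilinear_def)
    from linear_sum_axis[OF this, of w] show ?thesis
      by (simp add: matrix_vector_mult_def mult.commute)
  qed
  have "w = 0" if "?M z *v w = 0" for w
  proof (rule ccontr)
    assume "w \<noteq> 0"
    have "linear (\<lambda>u. B z u w)" using bilinear_B[OF z] by (simp add: bilinear_def)
    from linear_sum_axis[OF this, of w] have "B z w w = (\<Sum>i\<in>UNIV. w $ i * (?M z *v w) $ i)"
      by (simp add: M)
    then show False using B_pos[OF z \<open>w \<noteq> 0\<close>] that by simp
  qed
  then have "invertible (?M z)"
    by (metis invertible_left_inverse matrix_left_invertible_ker)
  then show "det (?M z) \<noteq> 0" by (simp add: invertible_det_nz)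
  have "2 * B z w (\<Gamma> z u v) = DB z u v w + DB z v u w - DB z w u v" for w
    using par z B_sym[OF z, of w] B_sym[OF z, of v "\<Gamma> z u w"] sym[OF z, of v u]
      sym[OF z, of w u] sym[OF z, of w v]
    by (simp add: parallel_def)
  then have "B z w (\<Gamma> z u v) = 1/2 * (DB z u v w + DB z v u w - DB z w u v)" for w
    by (simp add: field_simps)
  then show "?M z *v \<Gamma> z u v = ?c z" by (simp add: vec_eq_iff M)
qed

lemma l_has_derivative:
  assumes x: "x \<in> S" and \<gamma>: "(\<gamma> has_derivative \<gamma>') (at x)"
  shows "((\<lambda>z. l z (\<gamma> z)) has_derivative (\<lambda>w. Dl x w (\<gamma> x) + l x (\<gamma>' w))) (at x)"
proof -
  have comp: "((\<lambda>z. \<gamma> z $ k) has_derivative (\<lambda>w. \<gamma>' w $ k)) (at x)" for k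
    by (rule bounded_linear.has_derivative[OF bounded_linear_vec_nth \<gamma>])
  have lin: "linear (Dl x w)" for w
    using x by (intro linearI) (simp_all add: Dl_simps)
  have "((\<lambda>z. \<Sum>k\<in>UNIV. \<gamma> z $ k * l z (axis k 1)) has_derivative
      (\<lambda>w. \<Sum>k\<in>UNIV. \<gamma> x $ k * Dl x w (axis k 1) + \<gamma>' w $ k * l x (axis k 1))) (at x)"
    by (intro has_derivative_sum has_derivative_mult comp Dl x)
  moreover have "(\<Sum>k\<in>UNIV. \<gamma> x $ k * Dl x w (axis k 1) + \<gamma>' w $ k * l x (axis k 1)) =
      Dl x w (\<gamma> x) + l x (\<gamma>' w)" for w
    using linear_sum_axis[OF lin] linear_sum_axis[OF linear_l[OF x]] by (simp add: sum.distrib)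
  moreover have "(\<Sum>k\<in>UNIV. \<gamma> z $ k * l z (axis k 1)) = l z (\<gamma> z)" if "z \<in> S" for z
    using linear_sum_axis[OF linear_l[OF that]] by simp
  ultimately show ?thesis
    using has_derivative_transform_within_open[OF _ open_S x, of _ _ UNIV "\<lambda>z. l z (\<gamma> z)"] by simp
qed

lemma B_has_derivative:
  assumes x: "x \<in> S" and \<gamma>: "(\<gamma> has_derivative \<gamma>') (at x)"
  shows "((\<lambda>z. B z (\<gamma> z) v) has_derivative (\<lambda>w. DB x w (\<gamma> x) v + B x (\<gamma>' w) v)) (at x)"
proof -
  have comp: "((\<lambda>z. \<gamma> z $ k) has_derivative (\<lambda>w. \<gamma>' w $ k)) (at x)" for k
    by (rule bounded_linear.has_derivative[OF bounded_linear_vec_nth \<gamma>])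
  have lin: "linear (\<lambda>u. DB x w u v)" for w
    using x by (intro linearI) (simp_all add: DB_simps)
  have lin_B: "linear (\<lambda>u. B z u v)" if "z \<in> S" for z
    using bilinear_B[OF that] by (simp add: bilinear_def)
  have "((\<lambda>z. \<Sum>k\<in>UNIV. \<gamma> z $ k * B z (axis k 1) v) has_derivative
      (\<lambda>w. \<Sum>k\<in>UNIV. \<gamma> x $ k * DB x w (axis k 1) v + \<gamma>' w $ k * B x (axis k 1) v)) (at x)"
    by (intro has_derivative_sum has_derivative_mult comp DB x)
  moreover have "(\<Sum>k\<in>UNIV. \<gamma> x $ k * DB x w (axis k 1) v + \<gamma>' w $ k * B x (axis k 1) v) =
      DB x w (\<gamma> x) v + B x (\<gamma>' w) v" for w
    using linear_sum_axis[OF lin] linear_sum_axis[OF lin_B[OF x]] by (simp add: sum.distrib)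
  moreover have "(\<Sum>k\<in>UNIV. \<gamma> z $ k * B z (axis k 1) v) = B z (\<gamma> z) v" if "z \<in> S" for z
    using linear_sum_axis[OF lin_B[OF that]] by simp
  ultimately show ?thesis
    using has_derivative_transform_within_open[OF _ open_S x, of _ _ UNIV "\<lambda>z. B z (\<gamma> z) v"] by simp
qed

text \<open>
  Differentiating \<open>Dl z u v = l z (\<Gamma> z u v)\<close> once more in direction \<open>w\<close> and exchanging \<open>u\<close> with \<open>w\<close> gives
  two values that agree by symmetry of second derivatives; their difference is \<open>l x (R w u v)\<close>. For \<open>B\<close>
  the same works on the diagonal \<open>(v, v)\<close>, where the additional term \<open>B(\<Gamma>(w, v), \<Gamma>(u, v))\<close> is symmetric
  in \<open>u\<close> and \<open>w\<close> and cancels.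
\<close>

lemma parallel_curvature:
  assumes par: "parallel \<Gamma>" and x: "x \<in> S"
    and D\<Gamma>: "\<And>u v. ((\<lambda>z. \<Gamma> z u v) has_derivative (\<lambda>w. D\<Gamma> w u v)) (at x)"
  defines "R \<equiv> \<lambda>w u v. D\<Gamma> w u v + \<Gamma> x w (\<Gamma> x u v) - D\<Gamma> u w v - \<Gamma> x u (\<Gamma> x w v)"
  shows "l x (R w u v) = 0" and "B x (R w u v) v = 0"
proof -
  have DB: "DB z w u v = B z (\<Gamma> z w u) v + B z (\<Gamma> z w v) u" and Dl: "Dl z w v = l z (\<Gamma> z w v)"
    if "z \<in> S" for z w u v using par that B_sym[OF that] by (auto simp: parallel_def)
  have "frechet_derivative (\<lambda>z. Dl z u v) (at x) w = l x (\<Gamma> x w (\<Gamma> x u v)) + l x (D\<Gamma> w u v)" for u w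
  proof -
    have "((\<lambda>z. Dl z u v) has_derivative (\<lambda>w. Dl x w (\<Gamma> x u v) + l x (D\<Gamma> w u v))) (at x)"
      by (rule has_derivative_transform_within_open[OF l_has_derivative[OF x D\<Gamma>] open_S x])
         (simp add: Dl)
    from frechet_derivative_at[OF this, symmetric] show ?thesis by (simp add: Dl[OF x])
  qed
  then show "l x (R w u v) = 0"
    using Dl_second_symmetric[OF x, of u v w] x by (simp add: R_def l_simps)
  have "frechet_derivative (\<lambda>z. DB z u v v) (at x) w =
      2 * (B x (\<Gamma> x w (\<Gamma> x u v)) v + B x (\<Gamma> x w v) (\<Gamma> x u v) + B x (D\<Gamma> w u v) v)" for u w
  proof -
    have "((\<lambda>z. DB z u v v) has_derivative
        (\<lambda>w. 2 * (DB x w (\<Gamma> x u v) v + B x (D\<Gamma> w u v) v))) (at x)"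
      by (rule has_derivative_transform_within_open[OF
          has_derivative_mult_right[OF B_has_derivative[OF x D\<Gamma>]] open_S x])
         (simp add: DB)
    from frechet_derivative_at[OF this, symmetric] show ?thesis by (simp add: DB[OF x])
  qed
  then show "B x (R w u v) v = 0"
    using DB_second_symmetric[OF x, of u v v w] x B_sym[OF x, of "\<Gamma> x w v" "\<Gamma> x u v"]
    by (simp add: R_def B_simps)
qed

end

section \<open>Flag curvature of Randers metrics with parallel one-form\<close>

context randers_chart
begin

text \<open>
  The hypotheses on \<open>R\<close> leave only \<open>F / \<alpha> * B(R, u)\<close> of the fundamental tensor in the numerator. In the
  denominator the terms with \<open>F_y\<close> cancel because \<open>F_y\<close> at \<open>y\<close> is \<open>F\<close> and \<open>\<alpha>_yy\<close> has \<open>y\<close> in its kernel.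
  When the denominators vanish, both sides are 0.
\<close>

lemma flag_quotient_eq:
  assumes x: "x \<in> S" and y: "y \<noteq> 0" and R: "R = riemann_curvature F x y u"
    and "B x y R = 0" "l x R = 0"
  shows "flag_quotient F x y u = B x R u / ((F x y)\<^sup>2 * (B x u u - (B x y u)\<^sup>2 / B x y y))"
proof -
  note a = \<alpha>_pos[OF x y] F_pos[OF x y]
  have "g x y R u = F x y / \<alpha> x y * B x R u"
    by (simp add: g_def F_y_def \<alpha>_yy_def assms(4,5))
  moreover have "g x y y y * g x y u u - (g x y y u)\<^sup>2 = (F x y)\<^sup>2 * (F x y * \<alpha>_yy x y u u)"
    by (simp add: g_def F_y_self[OF x y] \<alpha>_yy_self[OF x y] algebra_simps power2_eq_square)
  moreover have "\<alpha>_yy x y u u = (B x u u - (B x y u)\<^sup>2 / B x y y) / \<alpha> x y"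
    using a by (simp add: \<alpha>_yy_def \<alpha>_square[OF x y, symmetric] field_simps power3_eq_cube power2_eq_square)
  ultimately have "flag_quotient F x y u = (F x y / \<alpha> x y * B x R u) /
      (F x y / \<alpha> x y * ((F x y)\<^sup>2 * (B x u u - (B x y u)\<^sup>2 / B x y y)))"
    by (simp add: flag_quotient_def fundamental_form_eq[OF x y] R)
  then show ?thesis using a by (subst (asm) mult_divide_mult_cancel_left) simp_all
qed

text \<open>
  Since \<open>R\<^sub>y\<close> is linear, kills \<open>y\<close> and takes values orthogonal to \<open>y\<close>, the quotient is the same for all
  vectors that span the plane together with \<open>y\<close>.
\<close>

lemma parallel_flag_quotient:
  assumes par: "parallel \<Gamma>"
    and \<Gamma>: "\<And>z. z \<in> S \<Longrightarrow> bilinear (\<Gamma> z)" and sym: "\<And>z u v. z \<in> S \<Longrightarrow> \<Gamma> z u v = \<Gamma> z v u"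
    and x: "x \<in> S" and y: "y \<noteq> 0" and s: "s \<noteq> 0" and u: "B x y u = 0"
    and D\<Gamma>: "\<And>u v. ((\<lambda>z. \<Gamma> z u v) has_derivative (\<lambda>w. D\<Gamma> w u v)) (at x)"
  shows "flag_quotient F x y (s *\<^sub>R u + t *\<^sub>R y) =
    B x (D\<Gamma> u y y + \<Gamma> x u (\<Gamma> x y y) - D\<Gamma> y u y - \<Gamma> x y (\<Gamma> x u y)) u / ((F x y)\<^sup>2 * B x u u)"
proof -
  define R where "R = riemann_curvature F x y"
  have R: "R w = D\<Gamma> w y y + \<Gamma> x w (\<Gamma> x y y) - D\<Gamma> y w y - \<Gamma> x y (\<Gamma> x w y)" for w
    unfolding R_def
    by (rule riemann_curvature_quadratic_spray[OF open_S x y _ \<Gamma> sym D\<Gamma>])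
       (simp_all add: parallel_imp_quadratic_spray[OF par _ _ sym])
  have R0: "B x y (R w) = 0" "l x (R w) = 0" for w
    using parallel_curvature[OF par x D\<Gamma>, of w y y] B_sym[OF x] by (simp_all add: R)
  have "linear R"
    unfolding R_def riemann_curvature_def
    by (intro linearI) (simp_all add: vec_eq_iff algebra_simps sum.distrib sum_distrib_left)
  moreover have "R y = 0" by (simp add: R)
  ultimately have R_plane: "R (s *\<^sub>R u + t *\<^sub>R y) = s *\<^sub>R R u"
    by (simp add: linear_add linear_cmul)
  have "flag_quotient F x y (s *\<^sub>R u + t *\<^sub>R y) = B x (R (s *\<^sub>R u + t *\<^sub>R y)) (s *\<^sub>R u + t *\<^sub>R y) /
      ((F x y)\<^sup>2 * (B x (s *\<^sub>R u + t *\<^sub>R y) (s *\<^sub>R u + t *\<^sub>R y) - (B x y (s *\<^sub>R u + t *\<^sub>R y))\<^sup>2 / B x y y))"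
    by (rule flag_quotient_eq[OF x y]) (simp_all add: R_def[symmetric] R0)
  also have "B x (R (s *\<^sub>R u + t *\<^sub>R y)) (s *\<^sub>R u + t *\<^sub>R y) = s\<^sup>2 * B x (R u) u"
    using x R0(1)[of u] B_sym[OF x, of "R u" y] by (simp add: R_plane B_simps power2_eq_square)
  also have "B x (s *\<^sub>R u + t *\<^sub>R y) (s *\<^sub>R u + t *\<^sub>R y) - (B x y (s *\<^sub>R u + t *\<^sub>R y))\<^sup>2 / B x y y = s\<^sup>2 * B x u u"
    using x u B_sym[OF x, of u y] B_pos[OF x y] by (simp add: B_simps power2_eq_square field_simps)
  also have "s\<^sup>2 * B x (R u) u / ((F x y)\<^sup>2 * (s\<^sup>2 * B x u u)) = B x (R u) u / ((F x y)\<^sup>2 * B x u u)"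
    using s by simp
  finally show ?thesis by (simp add: R)
qed

end

text \<open>
  The relation between the two Randers metrics; \<open>n\<close> stands for the length of \<open>X\<close>. The factor of \<open>l\<close> arises from
  \<open>g\<^sub>X(X, v) = (1 + n) (\<beta>(v) + 1 / n * n\<^sup>2 * \<beta>(v))\<close>. What matters below is that all factors are constant.
\<close>

locale randers_chart_pair =
  R: randers_chart S B l F + R': randers_chart S B' l' F'
  for S :: "(real ^ 'n::finite) set" and B l F B' l' F' +
  fixes n :: real
  assumes B'_eq: "\<And>x u v. x \<in> S \<Longrightarrow> B' x u v = (1 + n) * (B x u v + 1 / n * l x u * l x v)"
    and l'_eq: "\<And>x v. x \<in> S \<Longrightarrow> l' x v = (1 + n)\<^sup>2 * l x v"
begin

text \<open>
  The coefficients in the formulas for \<open>B'\<close> and \<open>l'\<close> are constant, so differentiating produces only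
  derivatives of \<open>B\<close> and \<open>l\<close>, and the product rule matches the rule for \<open>l \<otimes> l\<close>.
\<close>

lemma parallel_transfer:
  assumes "R.parallel \<Gamma>"
  shows "R'.parallel \<Gamma>"
  unfolding R'.parallel_def
proof (intro ballI conjI allI)
  fix x assume x: "x \<in> S"
  have DB: "R.DB x w u v = B x (\<Gamma> x w u) v + B x u (\<Gamma> x w v)" and Dl: "R.Dl x w v = l x (\<Gamma> x w v)"
    for w u v using assms x by (auto simp: R.parallel_def)
  define k where "k = 1 / n"
  have "R'.DB x w u v = (1 + n) * (R.DB x w u v + (k * l x u * R.Dl x w v + k * R.Dl x w u * l x v))"
    for w u v
  proof (rule R'.DB_unique[OF x])
    show "((\<lambda>x. (1 + n) * (B x u v + k * l x u * l x v)) has_derivative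
      (\<lambda>w. (1 + n) * (R.DB x w u v + (k * l x u * R.Dl x w v + k * R.Dl x w u * l x v)))) (at x)"
      using x by (auto intro!: derivative_eq_intros R.DB R.Dl)
  qed (simp add: B'_eq k_def)
  then show "R'.DB x w u v = B' x (\<Gamma> x w u) v + B' x u (\<Gamma> x w v)" for w u v
    using x by (simp add: B'_eq k_def[symmetric] DB Dl algebra_simps)
  have "R'.Dl x w v = (1 + n)\<^sup>2 * R.Dl x w v" for w v
    using x by (intro R'.Dl_unique[OF x, where f = "\<lambda>x. (1 + n)\<^sup>2 * l x v"])
       (auto intro!: derivative_eq_intros R.Dl simp: l'_eq)
  then show "R'.Dl x w v = l' x (\<Gamma> x w v)" for w v
    using x by (simp add: l'_eq Dl)
qed

text \<open>
  Both metrics have the same curvature. When \<open>u\<close> is an eigenvector of \<open>B'\<close> relative to \<open>B\<close>, its eigenvalue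
  cancels between numerator and denominator, so both quotients have the same \<open>\<kappa>\<close>, the sectional
  curvature of \<open>B\<close> times \<open>B x y y\<close>.
\<close>

lemma flag_quotient_ratio:
  assumes \<Gamma>: "\<And>x. x \<in> S \<Longrightarrow> bilinear (\<Gamma> x)" and sym: "\<And>x u v. x \<in> S \<Longrightarrow> \<Gamma> x u v = \<Gamma> x v u"
    and spray: "\<And>x y. x \<in> S \<Longrightarrow> y \<noteq> 0 \<Longrightarrow> (\<chi> i. spray F i x y) = (1/2) *\<^sub>R \<Gamma> x y y"
    and x: "x \<in> S" and y: "y \<noteq> 0" and u: "u \<noteq> 0" "B x y u = 0"
    and eigen: "\<And>v. B' x v u = \<mu> * B x v u" "\<mu> \<noteq> 0"
  obtains \<kappa> where
    "\<And>s t. s \<noteq> 0 \<Longrightarrow> flag_quotient F x y (s *\<^sub>R u + t *\<^sub>R y) = \<kappa> / (F x y)\<^sup>2"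
    "\<And>s t. s \<noteq> 0 \<Longrightarrow> flag_quotient F' x y (s *\<^sub>R u + t *\<^sub>R y) = \<kappa> / (F' x y)\<^sup>2"
proof -
  have par: "R.parallel \<Gamma>"
    by (rule R.quadratic_spray_imp_parallel[OF spray \<Gamma> sym])
  have D\<Gamma>: "((\<lambda>z. \<Gamma> z u v) has_derivative (\<lambda>w. frechet_derivative (\<lambda>z. \<Gamma> z u v) (at x) w)) (at x)" for u v
    using R.parallel_differentiable[OF par sym x] frechet_derivative_works by blast
  let ?R = "frechet_derivative (\<lambda>z. \<Gamma> z y y) (at x) u + \<Gamma> x u (\<Gamma> x y y) -
    frechet_derivative (\<lambda>z. \<Gamma> z u y) (at x) y - \<Gamma> x y (\<Gamma> x u y)"
  show thesis
  proof (rule that[of "B x ?R u / B x u u"])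
    fix s t :: real assume s: "s \<noteq> 0"
    show "flag_quotient F x y (s *\<^sub>R u + t *\<^sub>R y) = B x ?R u / B x u u / (F x y)\<^sup>2"
      by (subst R.parallel_flag_quotient[OF par \<Gamma> sym x y s u(2) D\<Gamma>]) (simp_all add: mult.commute)
    have "B' x y u = 0" using u eigen by simp
    then show "flag_quotient F' x y (s *\<^sub>R u + t *\<^sub>R y) = B x ?R u / B x u u / (F' x y)\<^sup>2"
      using eigen(2)
      by (subst R'.parallel_flag_quotient[OF parallel_transfer[OF par] \<Gamma> sym x y s _ D\<Gamma>])
         (simp_all add: eigen(1) mult.commute)
  qed
qed

end

section \<open>Charts and tangent vectors\<close>

context smooth_manifold
begin

lemma openin_chart_dom: "c \<in> A \<Longrightarrow> openin T (chart_dom c)"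
  using charts[of c] by (simp add: is_chart_def)

lemma chart_dom_subset: "c \<in> A \<Longrightarrow> chart_dom c \<subseteq> topspace T"
  using charts[of c] openin_subset[of T "chart_dom c"] by (simp add: is_chart_def)

lemma topspace_chart: "c \<in> A \<Longrightarrow> topspace (subtopology T (chart_dom c)) = chart_dom c"
  using chart_dom_subset[of c] by (simp add: inf_absorb2)

lemma inj_on_chart_map: "c \<in> A \<Longrightarrow> inj_on (chart_map c) (chart_dom c)"
  using charts homeomorphic_imp_injective_map topspace_chart unfolding is_chart_def by metis

lemma chart_inv_map: "c \<in> A \<Longrightarrow> p \<in> chart_dom c \<Longrightarrow> chart_inv c (chart_map c p) = p"
  using inj_on_chart_map by (simp add: chart_inv_def)

lemma chart_map_inv: "\<xi> \<in> chart_img c \<Longrightarrow> chart_map c (chart_inv c \<xi>) = \<xi>"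
  and chart_inv_in_dom: "\<xi> \<in> chart_img c \<Longrightarrow> chart_inv c \<xi> \<in> chart_dom c"
  by (simp_all add: chart_img_def chart_inv_def f_inv_into_f inv_into_into)

lemma chart_map_in_img: "p \<in> chart_dom c \<Longrightarrow> chart_map c p \<in> chart_img c"
  by (simp add: chart_img_def)

lemma open_chart_img: "c \<in> A \<Longrightarrow> open (chart_img c)"
  using charts by (simp add: is_chart_def)

lemma open_chart_image:
  assumes c: "c \<in> A" and U: "openin T U" "U \<subseteq> chart_dom c"
  shows "open (chart_map c ` U)"
proof -
  have "open_map (subtopology T (chart_dom c)) (top_of_set (chart_img c)) (chart_map c)"
    using charts[OF c] homeomorphic_imp_open_map by (auto simp: is_chart_def)
  moreover have "openin (subtopology T (chart_dom c)) U"
    using U by (auto simp: openin_subtopology)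
  ultimately have "openin (top_of_set (chart_img c)) (chart_map c ` U)"
    by (simp add: open_map_def)
  then show ?thesis
    using open_chart_img[OF c] by (simp add: openin_open_eq)
qed

lemma chart_at:
  assumes "p \<in> topspace T"
  shows "chart_at A p \<in> A" "p \<in> chart_dom (chart_at A p)"
proof -
  have "\<exists>c. c \<in> A \<and> p \<in> chart_dom c" using assms covering by blast
  from someI_ex[OF this] show "chart_at A p \<in> A" "p \<in> chart_dom (chart_at A p)"
    by (simp_all add: chart_at_def)
qed

lemma transition_has_derivative:
  assumes "c \<in> A" "d \<in> A" "p \<in> chart_dom c" "p \<in> chart_dom d"
  shows "((chart_map d \<circ> chart_inv c) has_derivative
    frechet_derivative (chart_map d \<circ> chart_inv c) (at (chart_map c p))) (at (chart_map c p))"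
proof -
  have "Ck_on (Suc 0) (chart_map c ` (chart_dom c \<inter> chart_dom d)) (chart_map d \<circ> chart_inv c)"
    using compatible[OF assms(1,2)] unfolding compatible_def smooth_on_def by blast
  then have "(chart_map d \<circ> chart_inv c) differentiable (at (chart_map c p))"
    using assms(3,4) by auto
  then show ?thesis by (simp add: frechet_derivative_works)
qed

text \<open>
  The map \<open>\<psi>\<close> has values in the manifold, so its derivative is only available through a chart. On the
  neighbourhood \<open>V\<close> of \<open>\<eta>\<close> it stays in the old chart, where the change of coordinates can be composed with
  it; elsewhere the chart maps take arbitrary values.
\<close>

lemma has_derivative_change_chart:
  assumes c: "c \<in> A" "d \<in> A" and p: "\<psi> \<eta> \<in> chart_dom c" "\<psi> \<eta> \<in> chart_dom d"
    and V: "open V" "\<eta> \<in> V" "\<And>z. z \<in> V \<Longrightarrow> \<psi> z \<in> chart_dom d"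
    and D: "((\<lambda>z. chart_map d (\<psi> z)) has_derivative D) (at \<eta>)"
  shows "((\<lambda>z. chart_map c (\<psi> z)) has_derivative
    (\<lambda>v. frechet_derivative (chart_map c \<circ> chart_inv d) (at (chart_map d (\<psi> \<eta>))) (D v))) (at \<eta>)"
proof -
  have "((\<lambda>z. (chart_map c \<circ> chart_inv d) (chart_map d (\<psi> z))) has_derivative
    (\<lambda>v. frechet_derivative (chart_map c \<circ> chart_inv d) (at (chart_map d (\<psi> \<eta>))) (D v))) (at \<eta>)"
    by (rule has_derivative_compose[OF D transition_has_derivative[OF c(2,1) p(2,1)]])
  from has_derivative_transform_within_open[OF this V(1,2)] V(3) chart_inv_map[OF c(2)]
  show ?thesis by simp
qed

lemma transition_inverse:
  assumes c: "c \<in> A" "d \<in> A" and p: "p \<in> chart_dom c" "p \<in> chart_dom d"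
  shows "frechet_derivative (chart_map c \<circ> chart_inv d) (at (chart_map d p))
    (frechet_derivative (chart_map d \<circ> chart_inv c) (at (chart_map c p)) v) = v"
proof -
  let ?V = "chart_map c ` (chart_dom c \<inter> chart_dom d)"
  have op: "open ?V"
    using c by (intro open_chart_image openin_Int openin_chart_dom) simp_all
  have \<eta>: "chart_map c p \<in> ?V" using p by auto
  have V: "chart_inv c z \<in> chart_dom c \<inter> chart_dom d" if "z \<in> ?V" for z
    using that chart_inv_map[OF c(1)] by auto
  have p': "chart_inv c (chart_map c p) = p" using c p by (simp add: chart_inv_map)
  have "((\<lambda>z. chart_map c (chart_inv c z)) has_derivative
    (\<lambda>v. frechet_derivative (chart_map c \<circ> chart_inv d) (at (chart_map d (chart_inv c (chart_map c p))))
      (frechet_derivative (chart_map d \<circ> chart_inv c) (at (chart_map c p)) v))) (at (chart_map c p))"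
    using transition_has_derivative[OF c p] V p' p
    by (intro has_derivative_change_chart[OF c _ _ op \<eta>]) (auto simp: comp_def)
  moreover have "((\<lambda>z. chart_map c (chart_inv c z)) has_derivative (\<lambda>v. v)) (at (chart_map c p))"
    by (rule has_derivative_transform_within_open[OF has_derivative_ident op \<eta>])
       (auto simp: chart_inv_map[OF c(1)])
  ultimately show ?thesis
    using has_derivative_unique by (metis (no_types, lifting) p')
qed

lemma from_to_coords:
  assumes "c \<in> A" "p \<in> chart_dom c"
  shows "from_coords A c p (to_coords A c p v) = v"
    and "to_coords A c p (from_coords A c p w) = w"
proof -
  have "p \<in> topspace T" using assms chart_dom_subset by blast
  note d = chart_at[OF this]
  show "from_coords A c p (to_coords A c p v) = v" "to_coords A c p (from_coords A c p w) = w"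
    unfolding from_coords_def to_coords_def
    using transition_inverse[OF d(1) assms(1) d(2) assms(2)]
      transition_inverse[OF assms(1) d(1) assms(2) d(2)] by simp_all
qed

lemma
  assumes "c \<in> A" "p \<in> chart_dom c"
  shows linear_from_coords: "linear (from_coords A c p)"
    and linear_to_coords: "linear (to_coords A c p)"
proof -
  have "p \<in> topspace T" using assms chart_dom_subset by blast
  note d = chart_at[OF this]
  show "linear (from_coords A c p)" "linear (to_coords A c p)"
    using transition_has_derivative[OF d(1) assms(1) d(2) assms(2), THEN has_derivative_linear]
      transition_has_derivative[OF assms(1) d(1) assms(2) d(2), THEN has_derivative_linear]
    unfolding from_coords_def[abs_def] to_coords_def[abs_def] by (simp_all add: eta_contract_eq)
qed

text \<open>
  Smoothness is postulated for the entries with respect to the coordinate basis only; bilinearity of the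
  metric and linearity of the coordinate change carry it over to all constant coordinate vectors.
\<close>

lemma Ck_on_metric_coords:
  assumes h: "riemannian_metric T A h" and c: "c \<in> A"
  shows "Ck_on k (chart_img c)
    (\<lambda>\<xi>. h (chart_inv c \<xi>) (from_coords A c (chart_inv c \<xi>) u) (from_coords A c (chart_inv c \<xi>) v))"
proof -
  let ?fc = "\<lambda>\<xi>. from_coords A c (chart_inv c \<xi>)"
  have "Ck_on k (chart_img c) (\<lambda>\<xi>. \<Sum>i\<in>UNIV. \<Sum>j\<in>UNIV.
      u $ i * (v $ j * h (chart_inv c \<xi>) (?fc \<xi> (axis i 1)) (?fc \<xi> (axis j 1))))"
    using h c open_chart_img[OF c]
    by (intro Ck_on_sum Ck_on_mult Ck_on_const)
       (simp_all add: riemannian_metric_def smooth_on_def)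
  then show ?thesis
  proof (rule Ck_on_cong[OF _ open_chart_img[OF c]])
    fix \<xi> assume \<xi>: "\<xi> \<in> chart_img c"
    note p = chart_inv_in_dom[OF \<xi>]
    have "bilinear (h (chart_inv c \<xi>))"
      using h p chart_dom_subset[OF c] by (auto simp: riemannian_metric_def)
    then have lin: "linear (\<lambda>v. h (chart_inv c \<xi>) z (?fc \<xi> v))" "linear (\<lambda>u. h (chart_inv c \<xi>) (?fc \<xi> u) z)"
      for z
      using linear_compose[OF linear_from_coords[OF c p], of "h (chart_inv c \<xi>) z"]
        linear_compose[OF linear_from_coords[OF c p], of "\<lambda>v. h (chart_inv c \<xi>) v z"]
      by (simp_all add: bilinear_def comp_def)
    have "(\<Sum>i\<in>UNIV. \<Sum>j\<in>UNIV.
      u $ i * (v $ j * h (chart_inv c \<xi>) (?fc \<xi> (axis i 1)) (?fc \<xi> (axis j 1)))) =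
      (\<Sum>i\<in>UNIV. u $ i *\<^sub>R (\<Sum>j\<in>UNIV. v $ j *\<^sub>R h (chart_inv c \<xi>) (?fc \<xi> (axis i 1)) (?fc \<xi> (axis j 1))))"
      by (simp add: sum_distrib_left)
    also have "\<dots> = h (chart_inv c \<xi>) (?fc \<xi> u) (?fc \<xi> v)"
      by (simp only: linear_sum_axis[OF lin(1)] linear_sum_axis[OF lin(2)])
    finally show "(\<Sum>i\<in>UNIV. \<Sum>j\<in>UNIV.
      u $ i * (v $ j * h (chart_inv c \<xi>) (?fc \<xi> (axis i 1)) (?fc \<xi> (axis j 1)))) =
      h (chart_inv c \<xi>) (?fc \<xi> u) (?fc \<xi> v)" .
  qed
qed

end

section \<open>Left-invariant vector fields\<close>

context lie_group
begin

lemma one_in_topspace: "\<one> \<in> topspace T"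
  by (simp add: topspace_eq)

lemma open_translate_preimage:
  assumes p: "p \<in> carrier G" and U: "openin T U"
  shows "openin T {z \<in> carrier G. p \<otimes> z \<in> U}"
proof -
  have "continuous_map T (prod_topology T T) (\<lambda>z. (p, z))"
    using p by (simp add: continuous_map_pairedI topspace_eq)
  from continuous_map_compose[OF this continuous_mult]
  have "continuous_map T T (\<lambda>z. p \<otimes> z)" by (simp add: comp_def)
  from openin_continuous_map_preimage[OF this U] show ?thesis by (simp add: topspace_eq)
qed

abbreviation mult_coords :: "('g, 'n) chart \<Rightarrow> ('g, 'n) chart \<Rightarrow> (real ^ 'n) \<times> (real ^ 'n) \<Rightarrow> real ^ 'n" where
  "mult_coords c d \<equiv> (\<lambda>(\<xi>, \<eta>). chart_map d (chart_inv c \<xi> \<otimes> chart_inv (chart_at A \<one>) \<eta>))"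

lemma smooth_mult_coords:
  assumes "c \<in> A" "d \<in> A"
  shows "Ck_on k {(\<xi>, \<eta>). \<xi> \<in> chart_img c \<and> \<eta> \<in> chart_img (chart_at A \<one>) \<and>
      chart_inv c \<xi> \<otimes> chart_inv (chart_at A \<one>) \<eta> \<in> chart_dom d} (mult_coords c d)"
  using smooth_mult[OF assms(1) chart_at(1)[OF one_in_topspace] assms(2)] by (simp add: smooth_on_def)

text \<open>
  The left-invariant field at \<open>p\<close> is the derivative of \<open>\<eta> \<mapsto> p \<otimes> \<eta>\<close> at the unit, hence the partial
  derivative of the multiplication in its second argument. Its definition uses the chart selected
  at \<open>p\<close>, which varies with \<open>p\<close> without any regularity; the chain rule replaces it by the fixed chart \<open>c\<close>.
\<close>

lemma left_invariant_field_coords: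
  assumes c: "c \<in> A" and p: "p \<in> chart_dom c"
  shows "to_coords A c p (left_invariant_field G A X p) =
    frechet_derivative (mult_coords c c) (at (chart_map c p, chart_map (chart_at A \<one>) \<one>)) (0, X)"
proof -
  let ?e = "chart_at A \<one>" and ?d = "chart_at A p"
  have pT: "p \<in> topspace T" using p c chart_dom_subset by blast
  then have pG: "p \<in> carrier G" by (simp add: topspace_eq)
  note e = chart_at[OF one_in_topspace] and d = chart_at[OF pT]
  let ?\<eta> = "chart_map ?e \<one>" and ?\<psi> = "\<lambda>\<eta>. p \<otimes> chart_inv ?e \<eta>"
  have \<psi>: "?\<psi> ?\<eta> = p" using e pG by (simp add: chart_inv_map)
  have \<eta>: "?\<eta> \<in> chart_img ?e" using e(2) by (rule chart_map_in_img)
  have deriv: "((\<lambda>\<eta>. chart_map b (?\<psi> \<eta>)) has_derivative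
      (\<lambda>v. frechet_derivative (mult_coords c b) (at (chart_map c p, ?\<eta>)) (0, v))) (at ?\<eta>)"
    if b: "b \<in> A" "p \<in> chart_dom b" for b
  proof -
    have "(mult_coords c b) differentiable (at (chart_map c p, ?\<eta>))"
      using smooth_mult_coords[OF c b(1), of "Suc 0"] \<psi> \<eta> b c p
      by (auto simp: chart_inv_map chart_map_in_img)
    then have m: "(mult_coords c b has_derivative
        frechet_derivative (mult_coords c b) (at (chart_map c p, ?\<eta>))) (at (chart_map c p, ?\<eta>))"
      by (simp add: frechet_derivative_works)
    have "((\<lambda>\<eta>. (chart_map c p, \<eta>)) has_derivative (\<lambda>v. (0, v))) (at ?\<eta>)"
      by (auto intro!: derivative_eq_intros)
    from has_derivative_compose[OF this m] show ?thesis
      using c p by (simp add: chart_inv_map)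
  qed
  let ?V = "chart_map ?e ` ({z \<in> carrier G. p \<otimes> z \<in> chart_dom ?d} \<inter> chart_dom ?e)"
  have V: "open ?V"
    using e d by (intro open_chart_image openin_Int open_translate_preimage[OF pG] openin_chart_dom) simp_all
  have \<eta>V: "?\<eta> \<in> ?V" using e d(2) pG by auto
  have \<psi>V: "?\<psi> z \<in> chart_dom ?d" if "z \<in> ?V" for z
    using that e by (auto simp: chart_inv_map)
  have "((\<lambda>\<eta>. chart_map c (?\<psi> \<eta>)) has_derivative (\<lambda>v. to_coords A c p
      (frechet_derivative (mult_coords c ?d) (at (chart_map c p, ?\<eta>)) (0, v)))) (at ?\<eta>)"
    using has_derivative_change_chart[OF c d(1) _ _ V \<eta>V \<psi>V deriv[OF d]] p d(2)
    unfolding \<psi> to_coords_def by simp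
  from has_derivative_unique[OF this deriv[OF c p]]
  have "to_coords A c p (frechet_derivative (mult_coords c ?d) (at (chart_map c p, ?\<eta>)) (0, X)) =
      frechet_derivative (mult_coords c c) (at (chart_map c p, ?\<eta>)) (0, X)"
    by (rule fun_cong)
  moreover have "left_invariant_field G A X p =
      frechet_derivative (mult_coords c ?d) (at (chart_map c p, ?\<eta>)) (0, X)"
    using frechet_derivative_at[OF deriv[OF d]] pG
    by (simp add: left_invariant_field_def differential_def comp_def fun_eq_iff)
  ultimately show ?thesis by simp
qed

lemma Ck_on_left_invariant_field_coords:
  assumes c: "c \<in> A"
  shows "Ck_on k (chart_img c)
    (\<lambda>\<xi>. to_coords A c (chart_inv c \<xi>) (left_invariant_field G A X (chart_inv c \<xi>)))"
proof -
  let ?e = "chart_at A \<one>"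
  note e = chart_at[OF one_in_topspace]
  let ?W = "{(\<xi>, \<eta>). \<xi> \<in> chart_img c \<and> \<eta> \<in> chart_img ?e \<and>
      chart_inv c \<xi> \<otimes> chart_inv ?e \<eta> \<in> chart_dom c}"
  have "Ck_on k ?W (\<lambda>z. frechet_derivative (mult_coords c c) (at z) (0, X))"
    using smooth_mult_coords[OF c c, of "Suc k"] by simp
  then have "Ck_on k (chart_img c)
      (\<lambda>\<xi>. frechet_derivative (mult_coords c c) (at (\<xi>, chart_map ?e \<one>)) (0, X))"
  proof (rule Ck_on_slice[OF open_chart_img[OF c], rotated])
    fix \<xi> assume \<xi>: "\<xi> \<in> chart_img c"
    then have "chart_inv c \<xi> \<in> carrier G"
      using chart_inv_in_dom[OF \<xi>] chart_dom_subset[OF c] by (auto simp: topspace_eq)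
    then show "(\<xi>, chart_map ?e \<one>) \<in> ?W"
      using \<xi> e chart_inv_in_dom by (simp add: chart_inv_map chart_map_in_img)
  qed
  then show ?thesis
    by (rule Ck_on_cong[OF _ open_chart_img[OF c]])
       (simp add: left_invariant_field_coords[OF c chart_inv_in_dom] chart_map_inv)
qed

lemma left_invariant_field_one: "left_invariant_field G A X \<one> = X"
proof -
  let ?e = "chart_at A \<one>"
  note e = chart_at[OF one_in_topspace]
  have "((\<lambda>\<eta>. chart_map ?e (\<one> \<otimes> chart_inv ?e \<eta>)) has_derivative (\<lambda>v. v)) (at (chart_map ?e \<one>))"
  proof (rule has_derivative_transform_within_open[OF has_derivative_ident open_chart_img[OF e(1)]
        chart_map_in_img[OF e(2)]])
    fix \<eta> assume \<eta>: "\<eta> \<in> chart_img ?e"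
    then have "chart_inv ?e \<eta> \<in> carrier G"
      using chart_inv_in_dom[OF \<eta>] chart_dom_subset[OF e(1)] by (auto simp: topspace_eq)
    then show "\<eta> = chart_map ?e (\<one> \<otimes> chart_inv ?e \<eta>)" using \<eta> by (simp add: chart_map_inv)
  qed
  from frechet_derivative_at[OF this, symmetric] show ?thesis
    by (simp add: left_invariant_field_def differential_def comp_def)
qed

lemma left_invariant_field_norm:
  assumes "left_invariant_metric G A h" "p \<in> carrier G"
  shows "h p (left_invariant_field G A X p) (left_invariant_field G A X p) = h \<one> X X"
  using assms unfolding left_invariant_metric_def left_invariant_field_def
  by (metis one_closed r_one)

end

section \<open>Left-invariant Randers metrics\<close>

lemma Cauchy_Schwarz_bilinear_form:
  fixes b :: "'a::real_vector \<Rightarrow> 'a \<Rightarrow> real"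
  assumes b: "bilinear b" and sym: "\<And>u v. b u v = b v u" and pos: "\<And>u. u \<noteq> 0 \<Longrightarrow> b u u > 0"
  shows "(b u v)\<^sup>2 \<le> b u u * b v v"
proof (cases "v = 0")
  case True
  then show ?thesis using b by (simp add: bilinear_rzero)
next
  case False
  define t where "t = b u v / b v v"
  have v: "b v v > 0" using False pos by simp
  have "b (u - t *\<^sub>R v) (u - t *\<^sub>R v) \<ge> 0"
    using pos[of "u - t *\<^sub>R v"] b by (cases "u - t *\<^sub>R v = 0") (auto simp: bilinear_lzero)
  also have "b (u - t *\<^sub>R v) (u - t *\<^sub>R v) = b u u - (b u v)\<^sup>2 / b v v"
    using b v sym[of v u]
    by (simp add: bilinear_lsub bilinear_rsub bilinear_lmul bilinear_rmul t_def field_simps power2_eq_square)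
  finally show ?thesis using v by (simp add: field_simps)
qed

lemma abs_less_form_norm:
  fixes b :: "'a::real_vector \<Rightarrow> 'a \<Rightarrow> real"
  assumes "bilinear b" "\<And>u v. b u v = b v u" "\<And>u. u \<noteq> 0 \<Longrightarrow> b u u > 0"
    and X: "b X X < 1" and y: "y \<noteq> 0"
  shows "\<bar>b X y\<bar> < sqrt (b y y)"
proof -
  have "(b X y)\<^sup>2 \<le> b X X * b y y"
    by (rule Cauchy_Schwarz_bilinear_form) fact+
  also have "\<dots> < b y y" using assms(3)[OF y] X by simp
  finally show ?thesis by (rule real_less_rsqrt[of "\<bar>b X y\<bar>", unfolded power2_abs])
qed

context lie_group
begin

lemma Ck_on_one_form_coords:
  assumes h: "riemannian_metric T A h" and c: "c \<in> A"
  shows "Ck_on k (chart_img c) (\<lambda>\<xi>. h (chart_inv c \<xi>) (left_invariant_field G A X (chart_inv c \<xi>))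
    (from_coords A c (chart_inv c \<xi>) v))"
proof -
  let ?fc = "\<lambda>\<xi>. from_coords A c (chart_inv c \<xi>)"
    and ?Xc = "\<lambda>\<xi>. to_coords A c (chart_inv c \<xi>) (left_invariant_field G A X (chart_inv c \<xi>))"
  have "Ck_on k (chart_img c) (\<lambda>\<xi>. \<Sum>i\<in>UNIV. ?Xc \<xi> $ i * h (chart_inv c \<xi>) (?fc \<xi> (axis i 1)) (?fc \<xi> v))"
    using c by (intro Ck_on_sum Ck_on_mult Ck_on_bounded_linear_comp[OF _ bounded_linear_vec_nth]
        Ck_on_left_invariant_field_coords Ck_on_metric_coords[OF h] open_chart_img)
  then show ?thesis
  proof (rule Ck_on_cong[OF _ open_chart_img[OF c]])
    fix \<xi> assume \<xi>: "\<xi> \<in> chart_img c"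
    note p = chart_inv_in_dom[OF \<xi>]
    have "linear (\<lambda>u. h (chart_inv c \<xi>) u (?fc \<xi> v))"
      using h p chart_dom_subset[OF c] by (auto simp: riemannian_metric_def bilinear_def)
    from linear_compose[OF linear_from_coords[OF c p] this]
    have "linear (\<lambda>u. h (chart_inv c \<xi>) (?fc \<xi> u) (?fc \<xi> v))" by (simp add: comp_def)
    from linear_sum_axis[OF this, of "?Xc \<xi>"]
    show "(\<Sum>i\<in>UNIV. ?Xc \<xi> $ i * h (chart_inv c \<xi>) (?fc \<xi> (axis i 1)) (?fc \<xi> v)) =
        h (chart_inv c \<xi>) (left_invariant_field G A X (chart_inv c \<xi>)) (?fc \<xi> v)"
      by (simp add: from_to_coords[OF c p])
  qed
qed

text \<open>
  The one-form is the metric dual of the field, so by the Cauchy-Schwarz inequality its norm is at most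
  the length of the field.
\<close>

lemma randers_chart_left_invariant:
  assumes h: "riemannian_metric T A h" and c: "c \<in> A"
    and less: "\<And>p. p \<in> carrier G \<Longrightarrow>
      h p (left_invariant_field G A X p) (left_invariant_field G A X p) < 1"
  shows "randers_chart (chart_img c)
    (\<lambda>\<xi> u v. h (chart_inv c \<xi>) (from_coords A c (chart_inv c \<xi>) u) (from_coords A c (chart_inv c \<xi>) v))
    (\<lambda>\<xi> v. h (chart_inv c \<xi>) (left_invariant_field G A X (chart_inv c \<xi>)) (from_coords A c (chart_inv c \<xi>) v))
    (local_rep A c (randers_metric h (left_invariant_field G A X)))"
proof (rule randers_chart.intro)
  let ?fc = "\<lambda>\<xi>. from_coords A c (chart_inv c \<xi>)" and ?X = "left_invariant_field G A X"
  show "open (chart_img c)" by (rule open_chart_img[OF c])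
  show "local_rep A c (randers_metric h ?X) \<xi> y =
      sqrt (h (chart_inv c \<xi>) (?fc \<xi> y) (?fc \<xi> y)) + h (chart_inv c \<xi>) (?X (chart_inv c \<xi>)) (?fc \<xi> y)" for \<xi> y
    by (simp add: local_rep_def randers_metric_def)
  show "Ck_on 2 (chart_img c) (\<lambda>\<xi>. h (chart_inv c \<xi>) (?fc \<xi> u) (?fc \<xi> v))" for u v
    by (rule Ck_on_metric_coords[OF h c])
  show "Ck_on 2 (chart_img c) (\<lambda>\<xi>. h (chart_inv c \<xi>) (?X (chart_inv c \<xi>)) (?fc \<xi> v))" for v
    by (rule Ck_on_one_form_coords[OF h c])
  fix \<xi> assume \<xi>: "\<xi> \<in> chart_img c"
  note p = chart_inv_in_dom[OF \<xi>]
  then have pT: "chart_inv c \<xi> \<in> topspace T" using chart_dom_subset[OF c] by auto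
  have h_p: "bilinear (h (chart_inv c \<xi>))" "\<And>v w. h (chart_inv c \<xi>) v w = h (chart_inv c \<xi>) w v"
    "\<And>v. v \<noteq> 0 \<Longrightarrow> h (chart_inv c \<xi>) v v > 0"
    using h pT by (auto simp: riemannian_metric_def)
  note lin = linear_from_coords[OF c p]
  show "bilinear (\<lambda>u v. h (chart_inv c \<xi>) (?fc \<xi> u) (?fc \<xi> v))"
    using linear_compose[OF lin, of "h (chart_inv c \<xi>) z" for z]
      linear_compose[OF lin, of "\<lambda>v. h (chart_inv c \<xi>) v z" for z] h_p(1)
    by (simp add: bilinear_def comp_def)
  show "linear (\<lambda>v. h (chart_inv c \<xi>) (?X (chart_inv c \<xi>)) (?fc \<xi> v))"
    using linear_compose[OF lin, of "h (chart_inv c \<xi>) z" for z] h_p(1)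
    by (simp add: bilinear_def comp_def)
  show "h (chart_inv c \<xi>) (?fc \<xi> u) (?fc \<xi> v) = h (chart_inv c \<xi>) (?fc \<xi> v) (?fc \<xi> u)" for u v
    by (rule h_p(2))
  fix y :: "real ^ 'n" assume "y \<noteq> 0"
  then have y: "?fc \<xi> y \<noteq> 0"
    using from_to_coords(2)[OF c p, of y] linear_0[OF linear_to_coords[OF c p]] by metis
  then show "h (chart_inv c \<xi>) (?fc \<xi> y) (?fc \<xi> y) > 0" by (rule h_p(3))
  show "\<bar>h (chart_inv c \<xi>) (?X (chart_inv c \<xi>)) (?fc \<xi> y)\<bar> < sqrt (h (chart_inv c \<xi>) (?fc \<xi> y) (?fc \<xi> y))"
    using abs_less_form_norm[OF h_p less y] pT by (simp add: topspace_eq)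
qed

text \<open>
  This covers \<open>g\<^sub>X\<close>, to which the preceding results on Randers metrics can therefore be applied as well.
\<close>

lemma riemannian_metric_rank_one_change:
  assumes h: "riemannian_metric T A h" and r: "r > 0" and k: "k \<ge> 0"
  shows "riemannian_metric T A (\<lambda>x v z. r * (h x v z +
    k * h x (left_invariant_field G A X x) v * h x (left_invariant_field G A X x) z))"
  unfolding riemannian_metric_def
proof (intro conjI ballI allI)
  let ?X = "left_invariant_field G A X"
  fix x assume "x \<in> topspace T"
  then have b: "bilinear (h x)" and sym: "\<And>v w. h x v w = h x w v" and pos: "\<And>v. v \<noteq> 0 \<Longrightarrow> h x v v > 0"
    using h by (auto simp: riemannian_metric_def)
  show "bilinear (\<lambda>v z. r * (h x v z + k * h x (?X x) v * h x (?X x) z))"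
    unfolding bilinear_def using b
    by (intro conjI allI linearI)
       (simp_all add: bilinear_ladd bilinear_radd bilinear_lmul bilinear_rmul algebra_simps)
  show "r * (h x v w + k * h x (?X x) v * h x (?X x) w) = r * (h x w v + k * h x (?X x) w * h x (?X x) v)"
    for v w using sym[of v w] by simp
  show "v \<noteq> 0 \<longrightarrow> 0 < r * (h x v v + k * h x (?X x) v * h x (?X x) v)" for v
    using pos[of v] r k by (simp add: add_pos_nonneg mult.assoc)
next
  let ?X = "left_invariant_field G A X"
  fix c i j assume c: "c \<in> A"
  let ?p = "chart_inv c" and ?fc = "\<lambda>\<xi>. from_coords A c (chart_inv c \<xi>)"
  show "smooth_on (chart_img c) (\<lambda>\<xi>. r * (h (?p \<xi>) (?fc \<xi> (axis i 1)) (?fc \<xi> (axis j 1)) +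
      k * h (?p \<xi>) (?X (?p \<xi>)) (?fc \<xi> (axis i 1)) * h (?p \<xi>) (?X (?p \<xi>)) (?fc \<xi> (axis j 1))))"
    unfolding smooth_on_def using c
    by (intro allI Ck_on_mult Ck_on_add Ck_on_const Ck_on_metric_coords[OF h]
        Ck_on_one_form_coords[OF h] open_chart_img)
qed

end

section \<open>Berwald metrics and flag curvature on a manifold\<close>

text \<open>
  The coefficients provided by the Berwald condition need not be symmetric in the lower indices, but only
  their symmetric part contributes to the spray.
\<close>

lemma berwald_connection:
  assumes "berwald_type A F" "c \<in> A"
  obtains \<Gamma> where "\<And>x. bilinear (\<Gamma> x)" "\<And>x u v. \<Gamma> x u v = \<Gamma> x v u"
    "\<And>x y. x \<in> chart_img c \<Longrightarrow> y \<noteq> 0 \<Longrightarrow>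
      (\<chi> i. spray (local_rep A c F) i x y) = (1/2) *\<^sub>R \<Gamma> x y y"
proof -
  obtain C where C: "\<And>x y i. x \<in> chart_img c \<Longrightarrow> y \<noteq> 0 \<Longrightarrow>
      spray (local_rep A c F) i x y = 1/2 * (\<Sum>j\<in>UNIV. \<Sum>k\<in>UNIV. C i j k x * y $ j * y $ k)"
    using assms unfolding berwald_type_def by blast
  define \<Gamma> where "\<Gamma> x u v = (\<chi> i. \<Sum>j\<in>UNIV. \<Sum>k\<in>UNIV. 1/2 * (C i j k x + C i k j x) * u $ j * v $ k)"
    for x u v
  show thesis
  proof (rule that[of \<Gamma>])
    show "bilinear (\<Gamma> x)" for x
      unfolding bilinear_def \<Gamma>_def
      by (intro conjI allI linearI)
         (simp_all add: vec_eq_iff algebra_simps sum.distrib sum_distrib_left add_divide_distrib)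
    show "\<Gamma> x u v = \<Gamma> x v u" for x u v
    proof -
      have "(\<Sum>j\<in>UNIV. \<Sum>k\<in>UNIV. 1/2 * (C i j k x + C i k j x) * u $ j * v $ k) =
        (\<Sum>j\<in>UNIV. \<Sum>k\<in>UNIV. 1/2 * (C i j k x + C i k j x) * v $ j * u $ k)" for i
        by (subst sum.swap) (simp add: algebra_simps)
      then show ?thesis by (simp add: \<Gamma>_def vec_eq_iff)
    qed
    show "(\<chi> i. spray (local_rep A c F) i x y) = (1/2) *\<^sub>R \<Gamma> x y y"
      if "x \<in> chart_img c" "y \<noteq> 0" for x y
    proof -
      have "(\<Sum>j\<in>UNIV. \<Sum>k\<in>UNIV. C i k j x * y $ j * y $ k) =
        (\<Sum>j\<in>UNIV. \<Sum>k\<in>UNIV. C i j k x * y $ j * y $ k)" for i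
        by (subst sum.swap) (simp add: mult_ac)
      moreover have "1/2 * (C i j k x + C i k j x) * y $ j * y $ k =
        1/2 * (C i j k x * y $ j * y $ k) + 1/2 * (C i k j x * y $ j * y $ k)" for i j k
        by (simp add: algebra_simps)
      ultimately have "(\<Sum>j\<in>UNIV. \<Sum>k\<in>UNIV. 1/2 * (C i j k x + C i k j x) * y $ j * y $ k) =
        (\<Sum>j\<in>UNIV. \<Sum>k\<in>UNIV. C i j k x * y $ j * y $ k)" for i
        by (simp only: sum.distrib sum_distrib_left[symmetric])
      then show ?thesis by (simp add: vec_eq_iff C[OF that] \<Gamma>_def)
    qed
  qed
qed

text \<open>
  The flag curvature is a definite description over all \<open>w\<close> that span \<open>P\<close> with \<open>y\<close>. The first hypothesis
  provides one such \<open>w\<close>, without which the description would not be unique.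
\<close>

lemma flag_curvature_eqI:
  assumes "span {u, y} = P"
    and "\<And>w. span {w, y} = P \<Longrightarrow>
      flag_quotient (local_rep A c F) (chart_map c p) (to_coords A c p y) (to_coords A c p w) = K"
  shows "flag_curvature A c F p y P = K"
  unfolding flag_curvature_def using assms by (intro the_equality) auto

lemma span_pair_eq_decompose:
  fixes u v w :: "'a::real_vector"
  assumes span: "span {w, v} = span {u, v}" and indep: "u \<notin> span {v}"
  obtains s t where "s \<noteq> 0" "w = s *\<^sub>R u + t *\<^sub>R v"
proof -
  have "w \<in> span {u, v}" using span span_base[of w "{w, v}"] by auto
  then obtain s where "w - s *\<^sub>R u \<in> span {v}" by (auto simp: span_breakdown_eq)
  then obtain t where "w - s *\<^sub>R u = t *\<^sub>R v" by (auto simp: span_singleton)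
  then have t: "w = s *\<^sub>R u + t *\<^sub>R v" by (simp add: algebra_simps)
  have "s \<noteq> 0"
  proof
    assume "s = 0"
    then have "span {w, v} \<subseteq> span {v}"
      using t by (intro span_minimal) (auto simp: span_base span_scale)
    then show False using indep span span_base[of u "{u, v}"] by auto
  qed
  then show thesis using t that by blast
qed

theorem proposition3p7:
  fixes G :: "('g, 'k) monoid_scheme"
    and T :: "'g topology"
    and A :: "('g, 'n::finite) chart set"
    and h gX :: "'g \<Rightarrow> real ^ 'n \<Rightarrow> real ^ 'n \<Rightarrow> real"
    and X :: "real ^ 'n"
    and Xf :: "'g \<Rightarrow> real ^ 'n"
    and F F' :: "'g \<Rightarrow> real ^ 'n \<Rightarrow> real"
    and nX :: real
    and \<phi> :: "real ^ 'n \<Rightarrow> real ^ 'n"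
    and E :: "'n \<Rightarrow> real ^ 'n"
    and lam :: "'n \<Rightarrow> real"
  assumes G: "lie_group G T A"
    and h: "riemannian_metric T A h" "left_invariant_metric G A h"
    and X: "X \<noteq> 0"
    and nX: "nX = sqrt (h \<one>\<^bsub>G\<^esub> X X)" "nX < 1"
    and Xf: "Xf = left_invariant_field G A X"
    and F: "F = randers_metric h Xf"
    and berwald: "berwald_type A F"
    and gX: "gX = (\<lambda>x v z. (1 + nX) * (h x v z + 1 / nX * h x (Xf x) v * h x (Xf x) z))"
    and gX_less: "sqrt (gX \<one>\<^bsub>G\<^esub> X X) < 1"
    and F': "F' = randers_metric gX Xf"
    and \<phi>: "linear \<phi>" "\<And>v z. gX \<one>\<^bsub>G\<^esub> v z = h \<one>\<^bsub>G\<^esub> v (\<phi> z)"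
    and orthonormal: "\<And>i j. h \<one>\<^bsub>G\<^esub> (E i) (E j) = (if i = j then 1 else 0)"
    and basis: "span (range E) = UNIV"
    and eigen: "\<And>i. \<phi> (E i) = lam i *\<^sub>R E i"
  shows "\<forall>c\<in>A. \<one>\<^bsub>G\<^esub> \<in> chart_dom c \<longrightarrow> (\<forall>i j. i \<noteq> j \<longrightarrow>
    flag_curvature A c F' \<one>\<^bsub>G\<^esub> (E j) (span {E i, E j}) =
      (1 + h \<one>\<^bsub>G\<^esub> X (E j))\<^sup>2 / (lam j * (1 + sqrt (lam j) * h \<one>\<^bsub>G\<^esub> X (E j))\<^sup>2) *
      flag_curvature A c F \<one>\<^bsub>G\<^esub> (E j) (span {E i, E j}))"
proof (intro ballI impI allI)
  interpret lie_group G T A by (rule G)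
  fix c and i j :: 'n assume c: "c \<in> A" and one: "\<one>\<^bsub>G\<^esub> \<in> chart_dom c" and ij: "i \<noteq> j"
  let ?x = "chart_map c \<one>\<^bsub>G\<^esub>" and ?to = "to_coords A c \<one>\<^bsub>G\<^esub>"
  have x: "?x \<in> chart_img c" "chart_inv c ?x = \<one>\<^bsub>G\<^esub>"
    using c one by (simp_all add: chart_map_in_img chart_inv_map)
  have h1: "bilinear (h \<one>\<^bsub>G\<^esub>)" "\<And>v w. h \<one>\<^bsub>G\<^esub> v w = h \<one>\<^bsub>G\<^esub> w v"
    "\<And>v. v \<noteq> 0 \<Longrightarrow> h \<one>\<^bsub>G\<^esub> v v > 0"
    using h(1) one_in_topspace by (auto simp: riemannian_metric_def)
  have nX_pos: "nX > 0" and nX_square: "h \<one>\<^bsub>G\<^esub> X X = nX\<^sup>2"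
    using h1(3)[OF X] nX(1) by simp_all
  have Xf_one: "Xf \<one>\<^bsub>G\<^esub> = X" by (simp add: Xf left_invariant_field_one)
  have norm: "h p (Xf p) (Xf p) = nX\<^sup>2" if "p \<in> carrier G" for p
    using left_invariant_field_norm[OF h(2) that] by (simp add: Xf nX_square)
  have gX_norm: "gX p (Xf p) (Xf p) = gX \<one>\<^bsub>G\<^esub> X X" if "p \<in> carrier G" for p
    using norm[OF that] norm[OF one_closed] by (simp add: gX Xf_one)
  have gX_riem: "riemannian_metric T A gX"
    unfolding gX Xf using nX_pos by (intro riemannian_metric_rank_one_change h) simp_all
  have norm_less: "h p (Xf p) (Xf p) < 1" if "p \<in> carrier G" for p
    using norm[OF that] nX_pos nX(2) by (simp add: power_less_one_iff)
  have gX_norm_less: "gX p (Xf p) (Xf p) < 1" if "p \<in> carrier G" for p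
    using gX_norm[OF that] gX_less by simp
  interpret P: randers_chart_pair "chart_img c"
    "\<lambda>\<xi> u v. h (chart_inv c \<xi>) (from_coords A c (chart_inv c \<xi>) u) (from_coords A c (chart_inv c \<xi>) v)"
    "\<lambda>\<xi> v. h (chart_inv c \<xi>) (Xf (chart_inv c \<xi>)) (from_coords A c (chart_inv c \<xi>) v)"
    "local_rep A c F"
    "\<lambda>\<xi> u v. gX (chart_inv c \<xi>) (from_coords A c (chart_inv c \<xi>) u) (from_coords A c (chart_inv c \<xi>) v)"
    "\<lambda>\<xi> v. gX (chart_inv c \<xi>) (Xf (chart_inv c \<xi>)) (from_coords A c (chart_inv c \<xi>) v)"
    "local_rep A c F'" nX
  proof (intro randers_chart_pair.intro randers_chart_pair_axioms.intro)
    show "randers_chart (chart_img c)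
      (\<lambda>\<xi> u v. h (chart_inv c \<xi>) (from_coords A c (chart_inv c \<xi>) u) (from_coords A c (chart_inv c \<xi>) v))
      (\<lambda>\<xi> v. h (chart_inv c \<xi>) (Xf (chart_inv c \<xi>)) (from_coords A c (chart_inv c \<xi>) v)) (local_rep A c F)"
      using randers_chart_left_invariant[OF h(1) c norm_less[unfolded Xf]] by (simp add: F Xf)
    show "randers_chart (chart_img c)
      (\<lambda>\<xi> u v. gX (chart_inv c \<xi>) (from_coords A c (chart_inv c \<xi>) u) (from_coords A c (chart_inv c \<xi>) v))
      (\<lambda>\<xi> v. gX (chart_inv c \<xi>) (Xf (chart_inv c \<xi>)) (from_coords A c (chart_inv c \<xi>) v)) (local_rep A c F')"
      using randers_chart_left_invariant[OF gX_riem c gX_norm_less[unfolded Xf]] by (simp add: F' Xf)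
    fix \<xi> assume \<xi>: "\<xi> \<in> chart_img c"
    then have "chart_inv c \<xi> \<in> carrier G"
      using chart_inv_in_dom[OF \<xi>] chart_dom_subset[OF c] by (auto simp: topspace_eq)
    from norm[OF this]
    show "gX (chart_inv c \<xi>) (Xf (chart_inv c \<xi>)) (from_coords A c (chart_inv c \<xi>) v) =
      (1 + nX)\<^sup>2 * h (chart_inv c \<xi>) (Xf (chart_inv c \<xi>)) (from_coords A c (chart_inv c \<xi>) v)" for v
      using nX_pos by (simp add: gX power2_eq_square field_simps)
  qed (simp add: gX)
  have lin_to: "linear ?to" by (rule linear_to_coords[OF c one])
  note from_to = from_to_coords(1)[OF c one]
  have E_nonzero: "E k \<noteq> 0" for k
    using orthonormal[of k k] h1(1) by (auto simp: bilinear_lzero)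
  then have to_nonzero: "?to (E k) \<noteq> 0" for k
    using from_to[of "E k"] linear_0[OF linear_from_coords[OF c one]] by metis
  have lam: "gX \<one>\<^bsub>G\<^esub> v (E k) = lam k * h \<one>\<^bsub>G\<^esub> v (E k)" for v k
    using h1(1) by (simp add: \<phi>(2) eigen bilinear_rmul)
  have lam_pos: "lam k > 0" for k
  proof -
    have "gX \<one>\<^bsub>G\<^esub> (E k) (E k) > 0"
      using gX_riem one_in_topspace E_nonzero by (auto simp: riemannian_metric_def)
    then show ?thesis by (simp add: lam orthonormal)
  qed
  obtain \<Gamma> where \<Gamma>: "\<And>x. bilinear (\<Gamma> x)" "\<And>x u v. \<Gamma> x u v = \<Gamma> x v u"
    "\<And>x y. x \<in> chart_img c \<Longrightarrow> y \<noteq> 0 \<Longrightarrow>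
      (\<chi> i. spray (local_rep A c F) i x y) = (1/2) *\<^sub>R \<Gamma> x y y"
    using berwald_connection[OF berwald c] by metis
  obtain \<kappa> where \<kappa>:
    "\<And>s t. s \<noteq> 0 \<Longrightarrow> flag_quotient (local_rep A c F) ?x (?to (E j)) (s *\<^sub>R ?to (E i) + t *\<^sub>R ?to (E j)) =
      \<kappa> / (local_rep A c F ?x (?to (E j)))\<^sup>2"
    "\<And>s t. s \<noteq> 0 \<Longrightarrow> flag_quotient (local_rep A c F') ?x (?to (E j)) (s *\<^sub>R ?to (E i) + t *\<^sub>R ?to (E j)) =
      \<kappa> / (local_rep A c F' ?x (?to (E j)))\<^sup>2"
  proof (rule P.flag_quotient_ratio[OF \<Gamma>(1,2,3) x(1) to_nonzero[of j] to_nonzero[of i], of "lam i"])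
    show "h (chart_inv c ?x) (from_coords A c (chart_inv c ?x) (?to (E j)))
      (from_coords A c (chart_inv c ?x) (?to (E i))) = 0"
      using ij by (simp add: x from_to orthonormal)
    show "gX (chart_inv c ?x) (from_coords A c (chart_inv c ?x) v)
      (from_coords A c (chart_inv c ?x) (?to (E i))) =
      lam i * h (chart_inv c ?x) (from_coords A c (chart_inv c ?x) v)
      (from_coords A c (chart_inv c ?x) (?to (E i)))" for v
      by (simp add: x from_to lam)
    show "lam i \<noteq> 0" using lam_pos[of i] by simp
  qed auto
  have indep: "E i \<notin> span {E j}"
  proof
    assume "E i \<in> span {E j}"
    then obtain r where "E i = r *\<^sub>R E j" by (auto simp: span_singleton)
    then have "h \<one>\<^bsub>G\<^esub> (E i) (E i) = r * h \<one>\<^bsub>G\<^esub> (E i) (E j)"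
      using h1(1) by (metis bilinear_rmul real_scaleR_def)
    then show False using ij by (simp add: orthonormal)
  qed
  have flag: "flag_curvature A c F0 \<one>\<^bsub>G\<^esub> (E j) (span {E i, E j}) = \<kappa> / (local_rep A c F0 ?x (?to (E j)))\<^sup>2"
    if \<kappa>: "\<And>s t. s \<noteq> 0 \<Longrightarrow> flag_quotient (local_rep A c F0) ?x (?to (E j))
        (s *\<^sub>R ?to (E i) + t *\<^sub>R ?to (E j)) = \<kappa> / (local_rep A c F0 ?x (?to (E j)))\<^sup>2"
    for F0
  proof (rule flag_curvature_eqI[OF refl])
    fix w assume "span {w, E j} = span {E i, E j}"
    then obtain s t where st: "s \<noteq> 0" "w = s *\<^sub>R E i + t *\<^sub>R E j"
      using span_pair_eq_decompose[OF _ indep] by metis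
    then show "flag_quotient (local_rep A c F0) ?x (?to (E j)) (?to w) =
        \<kappa> / (local_rep A c F0 ?x (?to (E j)))\<^sup>2"
      using \<kappa>[OF st(1), of t] by (simp add: linear_add[OF lin_to] linear_cmul[OF lin_to])
  qed
  have F_val: "local_rep A c F ?x (?to (E j)) = 1 + h \<one>\<^bsub>G\<^esub> X (E j)"
    by (simp add: local_rep_def x from_to F randers_metric_def Xf_one orthonormal)
  have F'_val: "local_rep A c F' ?x (?to (E j)) = sqrt (lam j) + lam j * h \<one>\<^bsub>G\<^esub> X (E j)"
    by (simp add: local_rep_def x from_to F' randers_metric_def Xf_one orthonormal lam)
  have F_nonzero: "1 + h \<one>\<^bsub>G\<^esub> X (E j) \<noteq> 0"
    using P.R.F_pos[OF x(1) to_nonzero[of j]] by (simp add: F_val)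
  have "sqrt (lam j) * sqrt (lam j) = lam j" using lam_pos[of j] by simp
  then have F'_square: "(sqrt (lam j) + lam j * h \<one>\<^bsub>G\<^esub> X (E j))\<^sup>2 =
      lam j * (1 + sqrt (lam j) * h \<one>\<^bsub>G\<^esub> X (E j))\<^sup>2"
    by (simp add: power2_eq_square algebra_simps)
  show "flag_curvature A c F' \<one>\<^bsub>G\<^esub> (E j) (span {E i, E j}) =
      (1 + h \<one>\<^bsub>G\<^esub> X (E j))\<^sup>2 / (lam j * (1 + sqrt (lam j) * h \<one>\<^bsub>G\<^esub> X (E j))\<^sup>2) *
      flag_curvature A c F \<one>\<^bsub>G\<^esub> (E j) (span {E i, E j})"
    using F_nonzero by (simp add: flag[OF \<kappa>(1)] flag[OF \<kappa>(2)] F_val F'_val F'_square)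
qed

end
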